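(* Let $n\ge2$ and $r\ge1$ be integers, and let the opinion graph $G=(V,E)$ be the star-like graph with $n$ branches and radius $r$. Let the spatial graph $\mathcal{G}=(\mathcal{V},\mathcal{E})$ be any finite connected graph, let $\tau$ be an integer with $\tau\in[r,2r)$, and let $(\zeta_t)$ be the attraction process with confidence threshold $\tau$, started from the uniform product measure, with time to fixation $T$. Then $$P(\zeta_T\equiv\mathrm{cst})\ \ge\ 1-\bigg(\frac{1}{\tau+1-r}\bigg)\frac{r(r+1)\,n}{2(1+rn)}.$$
   Context: Graphs are simple and undirected. The star-like graph with $n$ branches and radius $r$ is the tree consisting of a center vertex together with $n$ paths (branches) of length $r$ issued from the center and otherwise disjoint (so it has $1+rn$ vertices, with exactly $n$ vertices at distance $k$ from the center for each $k=1,\dots,r$). $d(\cdot,\cdot)$ is the geodesic distance on the opinion graph $G$. For $a\neq b$ in $V$, $D(a,b)=\{a'\in V:d(a,a')=1\text{ and }d(a',b)=d(a,b)-1\}$. Let $\vec{\mathcal{E}}$ be the set of directed edges $\vec{xy},\vec{yx}$ for $\{x,y\}\in\mathcal{E}$. The attraction process $(\zeta_t)$ is the continuous-time Markov chain on $V^{\mathcal{V}}$ (an opinion in $V$ at each vertex of $\mathcal{V}$), with right-continuous paths, in which each directed edge $\vec{xy}\in\vec{\mathcal{E}}$ becomes active at rate one, independently over directed edges and independently of $\zeta_0$. When $\vec{xy}$ becomes active and the opinions $a$ at $x$ and $b$ at $y$ satisfy $0<d(a,b)\le\tau$, the opinion at $x$ is replaced by an opinion chosen uniformly at random from $D(a,b)$;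 otherwise nothing changes. The time to fixation is $T=\inf\{t\ge0:\zeta_t=\zeta_s\text{ for all }s>t\}$ (with $\inf\varnothing=\infty$). The event $\{\zeta_T\equiv\mathrm{cst}\}$ is the event that $T<\infty$ and there is $c\in V$ with $\zeta_T(x)=c$ for all $x\in\mathcal{V}$. The uniform product measure is the initial distribution under which the opinions $\zeta_0(x)$, $x\in\mathcal{V}$, are independent and uniformly distributed on $V$. *)

theory Defs
  imports "HOL-Probability.Probability" "Graph_Theory.Graph_Theory"
begin

text \<open>
  A simple undirected graph is a symmetric loop-free \<^typ>\<open>'a pair_pre_digraph\<close>, so that
  \<^const>\<open>parcs\<close> is the set of directed edges \<open>xy\<close>, \<open>yx\<close> of the undirected edges \<open>{x,y}\<close>.
  The distance is only meaningful between vertices of the same connected component.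
\<close>

definition gdist :: "'a pair_pre_digraph \<Rightarrow> 'a \<Rightarrow> 'a \<Rightarrow> nat" where
  "gdist G a b = (LEAST k. \<exists>p. pre_digraph.awalk (with_proj G) a p b \<and> length p = k)"

definition toward :: "'a pair_pre_digraph \<Rightarrow> 'a \<Rightarrow> 'a \<Rightarrow> 'a set" where
  "toward G a b = {a' \<in> pverts G. gdist G a a' = 1 \<and> gdist G a' b = gdist G a b - 1}"

datatype star_vertex = Center | Branch nat nat

text \<open>\<open>Branch i k\<close> is the vertex at distance \<open>k\<close> from the center on branch \<open>i\<close>.\<close>

definition star_like :: "nat \<Rightarrow> nat \<Rightarrow> star_vertex pair_pre_digraph" where
  "star_like n r =
     (let E = {(Center, Branch i 1) | i. i < n \<and> 1 \<le> r}
            \<union> {(Branch i k, Branch i (k + 1)) | i k. i < n \<and> 1 \<le> k \<and> k + 1 \<le> r}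
      in \<lparr> pverts = insert Center {Branch i k | i k. i < n \<and> 1 \<le> k \<and> k \<le> r},
           parcs = E \<union> E\<inverse> \<rparr>)"

definition poisson_process :: "'w measure \<Rightarrow> real \<Rightarrow> (real \<Rightarrow> 'w \<Rightarrow> nat) \<Rightarrow> bool" where
  "poisson_process M lam N \<longleftrightarrow>
     (\<forall>t\<ge>0. N t \<in> measurable M (count_space UNIV)) \<and>
     (\<forall>\<omega>\<in>space M. N 0 \<omega> = 0 \<and> mono_on {0..} (\<lambda>t. N t \<omega>) \<and>
        (\<forall>t\<ge>0. \<forall>\<^sub>F s in at_right t. N s \<omega> = N t \<omega>)) \<and>
     (\<forall>s t. 0 \<le> s \<and> s < t \<longrightarrow>
        distr M (count_space UNIV) (\<lambda>\<omega>. N t \<omega> - N s \<omega>) = measure_pmf (poisson_pmf (lam * (t - s)))) \<and>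
     (\<forall>u :: nat \<Rightarrow> real. 0 \<le> u 0 \<and> mono u \<longrightarrow>
        prob_space.indep_vars M (\<lambda>_. count_space UNIV) (\<lambda>i \<omega>. N (u (Suc i)) \<omega> - N (u i) \<omega>) UNIV)"

definition jump_time :: "(real \<Rightarrow> nat) \<Rightarrow> real \<Rightarrow> bool" where
  "jump_time f t \<longleftrightarrow> 0 < t \<and> (\<forall>s. 0 \<le> s \<and> s < t \<longrightarrow> f s < f t)"

definition interacting :: "'o pair_pre_digraph \<Rightarrow> nat \<Rightarrow> 'o \<Rightarrow> 'o \<Rightarrow> bool" where
  "interacting G \<tau> a b \<longleftrightarrow> 0 < gdist G a b \<and> gdist G a b \<le> \<tau>"

text \<open>
  Effect on the configuration \<open>\<eta>\<close> of the activation of the directed edge \<open>xy\<close>;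
  \<open>c a b\<close> is the element of \<^term>\<open>toward G a b\<close> selected at this activation.
\<close>

definition attract ::
  "'o pair_pre_digraph \<Rightarrow> nat \<Rightarrow> ('o \<Rightarrow> 'o \<Rightarrow> 'o) \<Rightarrow> 'v \<times> 'v \<Rightarrow> ('v \<Rightarrow> 'o) \<Rightarrow> 'v \<Rightarrow> 'o" where
  "attract G \<tau> c e \<eta> =
     (case e of (x, y) \<Rightarrow>
        if interacting G \<tau> (\<eta> x) (\<eta> y) then \<eta>(x := c (\<eta> x) (\<eta> y)) else \<eta>)"

datatype ('v, 'o) source = Initial | Clock "'v \<times> 'v" | Choice "'v \<times> 'v" nat 'o 'o

text \<open>
  The process driven by its activations: \<open>N e t\<close> counts the activations of the directed edge \<open>e\<close>
  up to time \<open>t\<close>, and \<open>U e k a b\<close> is the random element of \<^term>\<open>toward G a b\<close> that is used if the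
  opinions at the two ends of \<open>e\<close> are \<open>a\<close> and \<open>b\<close> at the \<open>k\<close>-th activation of \<open>e\<close>. The initial
  configuration, the clocks and all the choices are independent. The values of \<open>N\<close> and \<open>\<zeta>\<close> at
  negative times are irrelevant. Simultaneous activations have probability zero, which is why the
  evolution rule is imposed almost surely.
\<close>

locale attraction_process = prob_space M
  for M :: "'w measure" +
  fixes G :: "'o pair_pre_digraph"
    and S :: "'v pair_pre_digraph"
    and \<tau> :: nat
    and N :: "'v \<times> 'v \<Rightarrow> real \<Rightarrow> 'w \<Rightarrow> nat"
    and U :: "'v \<times> 'v \<Rightarrow> nat \<Rightarrow> 'o \<Rightarrow> 'o \<Rightarrow> 'w \<Rightarrow> 'o"
    and \<zeta> :: "real \<Rightarrow> 'w \<Rightarrow> 'v \<Rightarrow> 'o"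
  assumes clocks: "e \<in> parcs S \<Longrightarrow> poisson_process M 1 (N e)"
    and choices_measurable:
      "\<lbrakk>e \<in> parcs S; a \<in> pverts G; b \<in> pverts G; interacting G \<tau> a b\<rbrakk>
        \<Longrightarrow> U e k a b \<in> measurable M (count_space UNIV)"
    and choices_uniform:
      "\<lbrakk>e \<in> parcs S; a \<in> pverts G; b \<in> pverts G; interacting G \<tau> a b\<rbrakk>
        \<Longrightarrow> distr M (count_space UNIV) (U e k a b) = measure_pmf (pmf_of_set (toward G a b))"
    and independence:
      "indep_sets
         (\<lambda>i. case i of
             Initial \<Rightarrow> {\<zeta> 0 -` A \<inter> space M | A. True}
           | Clock e \<Rightarrow> sigma_sets (space M) {N e t -` A \<inter> space M | t A. 0 \<le> t}
           | Choice e k a b \<Rightarrow> {U e k a b -` A \<inter> space M | A. True})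
         ({Initial} \<union> Clock ` parcs S \<union>
          {Choice e k a b | e k a b.
             e \<in> parcs S \<and> a \<in> pverts G \<and> b \<in> pverts G \<and> interacting G \<tau> a b})"
    and process_measurable:
      "0 \<le> t \<Longrightarrow> \<zeta> t \<in> measurable M (count_space (pverts S \<rightarrow>\<^sub>E pverts G))"
    and right_continuous:
      "\<lbrakk>\<omega> \<in> space M; 0 \<le> t\<rbrakk> \<Longrightarrow> \<forall>\<^sub>F s in at_right t. \<zeta> s \<omega> = \<zeta> t \<omega>"
    and evolution:
      "AE \<omega> in M. \<forall>t>0.
         (\<forall>e\<in>parcs S. jump_time (\<lambda>s. N e s \<omega>) t \<longrightarrow>
            (\<forall>\<^sub>F s in at_left t. \<zeta> t \<omega> = attract G \<tau> (\<lambda>a b. U e (N e t \<omega>) a b \<omega>) e (\<zeta> s \<omega>))) \<and>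
         ((\<forall>e\<in>parcs S. \<not> jump_time (\<lambda>s. N e s \<omega>) t) \<longrightarrow>
            (\<forall>\<^sub>F s in at_left t. \<zeta> t \<omega> = \<zeta> s \<omega>))"

definition uniform_product_start ::
  "'w measure \<Rightarrow> 'o pair_pre_digraph \<Rightarrow> 'v pair_pre_digraph \<Rightarrow> ('w \<Rightarrow> 'v \<Rightarrow> 'o) \<Rightarrow> bool" where
  "uniform_product_start M G S \<zeta>0 \<longleftrightarrow>
     prob_space.indep_vars M (\<lambda>_. count_space UNIV) (\<lambda>x \<omega>. \<zeta>0 \<omega> x) (pverts S) \<and>
     (\<forall>x\<in>pverts S. distr M (count_space UNIV) (\<lambda>\<omega>. \<zeta>0 \<omega> x) = measure_pmf (pmf_of_set (pverts G)))"

definition fixation_time :: "(real \<Rightarrow> 'w \<Rightarrow> 'v \<Rightarrow> 'o) \<Rightarrow> 'w \<Rightarrow> ereal" where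
  "fixation_time \<zeta> \<omega> = Inf {ereal t | t. 0 \<le> t \<and> (\<forall>s>t. \<zeta> t \<omega> = \<zeta> s \<omega>)}"

definition consensus_event ::
  "'w measure \<Rightarrow> 'o pair_pre_digraph \<Rightarrow> 'v pair_pre_digraph \<Rightarrow> (real \<Rightarrow> 'w \<Rightarrow> 'v \<Rightarrow> 'o) \<Rightarrow> 'w set" where
  "consensus_event M G S \<zeta> =
     {\<omega> \<in> space M. fixation_time \<zeta> \<omega> < \<infinity> \<and>
        (\<exists>c\<in>pverts G. \<forall>x\<in>pverts S. \<zeta> (real_of_ereal (fixation_time \<zeta> \<omega>)) \<omega> x = c)}"

end

theory Submission
  imports Defs
begin

text \<open>
  In a star-like graph the neighbour that leads from \<open>a\<close> towards \<open>b\<close> is unique, so the choices are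
  almost surely deterministic. Let \<open>\<Phi>\<close> be the sum over all vertices of the distance of their opinion
  to the center. If \<open>x\<close> and \<open>y\<close> interact, then the activations of \<open>xy\<close> and \<open>yx\<close>, which have equal
  rates, change \<open>\<Phi>\<close> once by \<open>+1\<close> and once by \<open>-1\<close> (same branch, or one opinion at the center) or
  twice by \<open>-1\<close> (different branches). Hence \<open>\<Phi>\<close> is a supermartingale, and a strictly concave
  increasing function of \<open>\<Phi>\<close> has drift at most \<open>-1\<close> as long as some pair interacts; so the process
  is frozen at time \<open>t\<close> with probability \<open>1 - O(1/t)\<close>. In a frozen configuration, an opinion at
  distance at most \<open>\<tau> - r\<close> from the center is within distance \<open>\<tau>\<close> of every opinion, hence is shared
  by all neighbours and, by connectedness, by everybody. Without consensus \<open>\<Phi>\<close> is therefore at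
  least \<open>\<tau> + 1 - r\<close> times the number of vertices, and Markov's inequality gives the bound.

  To avoid stochastic calculus, time is cut into steps of length \<open>h\<close>. The chain that acts in a step
  only if exactly one activation occurs there is a discrete Markov chain with an explicit generator,
  and it agrees with the process up to time \<open>m h\<close> outside an event of probability \<open>O(m h\<^sup>2)\<close>.
\<close>

section \<open>Star-like graphs\<close>

text \<open>Certificate for distances to \<open>b\<close>: following \<open>descent\<close> builds a
  walk of length \<open>d a\<close>, while \<open>lipschitz\<close> forbids a shorter one, since
  each arc lowers \<open>d\<close> by at most one.\<close>

lemma gdist_eqI:
  fixes d :: "'a \<Rightarrow> nat"
  assumes zero: "\<And>a. a \<in> pverts G \<Longrightarrow> d a = 0 \<longleftrightarrow> a = b"
    and lipschitz: "\<And>a a'. (a, a') \<in> parcs G \<Longrightarrow> d a \<le> Suc (d a')"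
    and descent: "\<And>a. \<lbrakk>a \<in> pverts G; a \<noteq> b\<rbrakk> \<Longrightarrow> \<exists>a'\<in>pverts G. (a, a') \<in> parcs G \<and> d a = Suc (d a')"
    and b: "b \<in> pverts G"
    and a: "a \<in> pverts G"
  shows "gdist G a b = d a"
proof -
  have ex: "\<exists>p. pre_digraph.awalk (with_proj G) a p b \<and> length p = d a" if "a \<in> pverts G" for a
    using that
  proof (induction "d a" arbitrary: a)
    case 0
    then have "a = b" using zero by metis
    then show ?case using 0 by (intro exI[of _ "[]"]) (simp add: pre_digraph.awalk_def pre_digraph.cas.simps)
  next
    case (Suc k)
    then have "a \<noteq> b" using zero b by force
    then obtain a' where a': "a' \<in> pverts G" "(a, a') \<in> parcs G" "d a = Suc (d a')"
      using descent Suc.prems by blast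
    then obtain p where p: "pre_digraph.awalk (with_proj G) a' p b" "length p = d a'"
      using Suc.hyps by fastforce
    show ?case using a' p Suc.prems
      by (intro exI[of _ "(a, a') # p"]) (simp add: pre_digraph.awalk_def pre_digraph.cas.simps)
  qed
  have "d a \<le> length p" if "set p \<subseteq> parcs G" "pre_digraph.cas (with_proj G) a p b" for a p
    using that
  proof (induction p arbitrary: a)
    case Nil
    then show ?case using zero[OF b] by (simp add: pre_digraph.cas.simps)
  next
    case (Cons e p)
    obtain a1 a' where e: "e = (a1, a')" by (cases e)
    have arc: "(a, a') \<in> parcs G" and "d a' \<le> length p"
      using Cons e by (auto simp: pre_digraph.cas.simps)
    then show ?case using lipschitz[OF arc] by simp
  qed
  then have le: "d a \<le> length p" if "pre_digraph.awalk (with_proj G) a p b" for p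
    using that by (simp add: pre_digraph.awalk_def)
  show ?thesis
    unfolding gdist_def using ex[OF a] le by (intro Least_equality) auto
qed

section \<open>Explicit levels, distances and geodesic steps in the star\<close>

fun level :: "star_vertex \<Rightarrow> nat" where
  "level Center = 0"
| "level (Branch i k) = k"

text \<open>On a common branch one of the two truncated differences is zero, so their sum is the
  absolute difference of the levels.\<close>

fun star_dist :: "star_vertex \<Rightarrow> star_vertex \<Rightarrow> nat" where
  "star_dist (Branch i k) (Branch j l) = (if i = j then (k - l) + (l - k) else k + l)"
| "star_dist a b = level a + level b"

fun inward :: "star_vertex \<Rightarrow> star_vertex" where
  "inward Center = Center"
| "inward (Branch i k) = (if k \<le> 1 then Center else Branch i (k - 1))"

text \<open>The step is outward only if \<open>a\<close> lies on the path from the center to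
  \<open>b\<close>. The value at \<open>a = b\<close> is arbitrary, because equal opinions never
  interact.\<close>

fun star_step :: "star_vertex \<Rightarrow> star_vertex \<Rightarrow> star_vertex" where
  "star_step Center (Branch j l) = Branch j 1"
| "star_step (Branch i k) (Branch j l) =
     (if i = j \<and> k < l then Branch i (k + 1) else inward (Branch i k))"
| "star_step a Center = inward a"

lemma star_verts:
  "Center \<in> pverts (star_like n r)"
  "Branch i k \<in> pverts (star_like n r) \<longleftrightarrow> i < n \<and> 1 \<le> k \<and> k \<le> r"
  by (auto simp: star_like_def Let_def)

lemma star_arcs:
  "(Center, Center) \<notin> parcs (star_like n r)"
  "(Center, Branch j l) \<in> parcs (star_like n r) \<longleftrightarrow> j < n \<and> 1 \<le> r \<and> l = 1"
  "(Branch i k, Center) \<in> parcs (star_like n r) \<longleftrightarrow> i < n \<and> 1 \<le> r \<and> k = 1"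
  "(Branch i k, Branch j l) \<in> parcs (star_like n r) \<longleftrightarrow>
     i < n \<and> j = i \<and> 1 \<le> k \<and> 1 \<le> l \<and> k \<le> r \<and> l \<le> r \<and> (l = Suc k \<or> k = Suc l)"
  by (auto simp: star_like_def Let_def)

lemma finite_star_verts: "finite (pverts (star_like n r))"
proof -
  have "pverts (star_like n r) \<subseteq> insert Center ((\<lambda>(i, k). Branch i k) ` ({..<n} \<times> {..r}))"
    by (auto simp: star_like_def Let_def)
  then show ?thesis by (rule finite_subset) auto
qed

lemma star_step_in_verts:
  assumes "a \<in> pverts (star_like n r)" "b \<in> pverts (star_like n r)" "a \<noteq> b"
  shows "star_step a b \<in> pverts (star_like n r)"
  using assms by (cases a; cases b) (auto simp: star_verts)

lemma star_step_in_arcs: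
  assumes "a \<in> pverts (star_like n r)" "b \<in> pverts (star_like n r)" "a \<noteq> b"
  shows "(a, star_step a b) \<in> parcs (star_like n r)"
  using assms by (cases a; cases b) (auto simp: star_verts star_arcs)

lemma star_dist_star_step:
  assumes "a \<in> pverts (star_like n r)" "b \<in> pverts (star_like n r)" "a \<noteq> b"
  shows "star_dist a b = Suc (star_dist (star_step a b) b)"
  using assms by (cases a; cases b) (auto simp: star_verts)

lemma gdist_star:
  assumes "a \<in> pverts (star_like n r)" "b \<in> pverts (star_like n r)"
  shows "gdist (star_like n r) a b = star_dist a b"
proof (rule gdist_eqI[where d = "\<lambda>a. star_dist a b"])
  show "star_dist a b = 0 \<longleftrightarrow> a = b" if "a \<in> pverts (star_like n r)" for a
    using that assms by (cases a; cases b) (auto simp: star_verts)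
  show "star_dist a b \<le> Suc (star_dist a' b)" if "(a, a') \<in> parcs (star_like n r)" for a a'
    using that by (cases a; cases a'; cases b) (auto simp: star_arcs)
  show "\<exists>a'\<in>pverts (star_like n r). (a, a') \<in> parcs (star_like n r) \<and> star_dist a b = Suc (star_dist a' b)"
    if "a \<in> pverts (star_like n r)" "a \<noteq> b" for a
    using star_step_in_verts star_step_in_arcs star_dist_star_step that assms(2) by blast
qed (use assms in auto)

text \<open>The neighbours of a branch vertex lie one step inward or one step outward on its branch,
  and only \<open>star_step a b\<close> is closer to \<open>b\<close>; at the center, the branch of
  \<open>b\<close> decides. This is what makes the random choices deterministic.\<close>

lemma toward_star:
  assumes "a \<in> pverts (star_like n r)" "b \<in> pverts (star_like n r)" "a \<noteq> b"
  shows "toward (star_like n r) a b = {star_step a b}"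
proof -
  have one: "star_dist a (star_step a b) = 1"
    using assms by (cases a; cases b) (auto simp: star_verts)
  have unique: "a' = star_step a b"
    if a': "a' \<in> pverts (star_like n r)" and "star_dist a a' = 1"
      and eq: "star_dist a' b = star_dist a b - 1" for a'
  proof (cases a)
    case Center
    then obtain i where "a' = Branch i 1"
      using a' \<open>star_dist a a' = 1\<close> by (cases a') auto
    then show ?thesis
      using Center eq assms by (cases b) (auto simp: star_verts split: if_splits)
  next
    case (Branch i k)
    then have "a' = inward a \<or> a' = Branch i (Suc k)"
      using a' \<open>star_dist a a' = 1\<close> assms by (cases a') (auto simp: star_verts split: if_splits)
    then show ?thesis
      using Branch eq assms by (cases b) (auto simp: star_verts split: if_splits)
  qed
  show ?thesis
  proof (intro equalityI subsetI)
    fix a' assume "a' \<in> toward (star_like n r) a b"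
    then show "a' \<in> {star_step a b}"
      using unique[of a'] assms by (auto simp: toward_def gdist_star)
  next
    fix a' assume "a' \<in> {star_step a b}"
    then show "a' \<in> toward (star_like n r) a b"
      using one assms star_step_in_verts[OF assms] star_dist_star_step[OF assms]
      by (simp add: toward_def gdist_star)
  qed
qed

text \<open>An opinion moves outward only if it lies between the center and the other opinion, and
  then the other one moves inward. So the case of two outward moves is missing.\<close>

lemma level_star_step:
  assumes "a \<in> pverts (star_like n r)" "b \<in> pverts (star_like n r)" "a \<noteq> b"
  shows "level (star_step a b) = Suc (level a) \<and> level b = Suc (level (star_step b a)) \<or>
         level a = Suc (level (star_step a b)) \<and> level (star_step b a) = Suc (level b) \<or>
         level a = Suc (level (star_step a b)) \<and> level b = Suc (level (star_step b a))"
  using assms by (cases a; cases b) (auto simp: star_verts)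

lemma star_dist_le: "star_dist a b \<le> level a + level b"
  by (cases a; cases b) auto

text \<open>Each level from \<open>1\<close> to \<open>r\<close> occurs on \<open>n\<close>
  branches; the factor 2 avoids a division of natural numbers.\<close>

lemma sum_level_star: "2 * (\<Sum>a\<in>pverts (star_like n r). level a) = r * (r + 1) * n"
  and card_star_verts: "card (pverts (star_like n r)) = 1 + r * n"
proof -
  let ?B = "\<lambda>(i, k). Branch i k"
  have V: "pverts (star_like n r) = insert Center (?B ` ({..<n} \<times> {1..r}))"
    by (auto simp: star_like_def Let_def)
  have inj: "inj_on ?B ({..<n} \<times> {1..r})" by (auto simp: inj_on_def)
  have "Center \<notin> ?B ` ({..<n} \<times> {1..r})" by auto
  then show "card (pverts (star_like n r)) = 1 + r * n"
    unfolding V using card_image[OF inj] by (simp add: card_cartesian_product)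
  have "(\<Sum>a\<in>pverts (star_like n r). level a) = (\<Sum>(i, k)\<in>{..<n} \<times> {1..r}. k)"
    unfolding V using \<open>Center \<notin> _\<close> sum.reindex[OF inj, of level]
    by (simp add: case_prod_beta comp_def)
  also have "\<dots> = n * (\<Sum>k=1..r. k)"
    by (simp add: sum.cartesian_product[symmetric])
  finally show "2 * (\<Sum>a\<in>pverts (star_like n r). level a) = r * (r + 1) * n"
    using Sum_Icc_nat[of 1 r] by (simp add: algebra_simps)
qed

section \<open>Piecewise constant paths\<close>

text \<open>Continuous induction. At the infimum of the failures, \<open>left\<close> gives
  \<open>P\<close>, and then \<open>right\<close> extends it to a neighbourhood beyond, which
  contradicts the choice of the infimum.\<close>

lemma real_interval_induct:
  fixes s t :: real
  assumes "s \<le> t" "P s"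
    and right: "\<And>u. \<lbrakk>s \<le> u; u < t; P u\<rbrakk> \<Longrightarrow> \<forall>\<^sub>F v in at_right u. P v"
    and left: "\<And>u. \<lbrakk>s < u; u \<le> t; \<And>v. \<lbrakk>s \<le> v; v < u\<rbrakk> \<Longrightarrow> P v\<rbrakk> \<Longrightarrow> P u"
  shows "P t"
proof (rule ccontr)
  assume "\<not> P t"
  define A where "A = {u \<in> {s..t}. \<not> P u}"
  define u where "u = Inf A"
  have "t \<in> A" and bdd: "bdd_below A"
    using \<open>\<not> P t\<close> \<open>s \<le> t\<close> by (auto simp: A_def bdd_below_def)
  have "u \<le> t"
    unfolding u_def by (rule cInf_lower[OF \<open>t \<in> A\<close> bdd])
  have "s \<le> u"
    unfolding u_def using \<open>t \<in> A\<close> by (intro cInf_greatest) (auto simp: A_def)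
  have "P v" if "s \<le> v" "v < u" for v
  proof (rule ccontr)
    assume "\<not> P v"
    then have "v \<in> A" using that \<open>u \<le> t\<close> by (simp add: A_def)
    then show False using cInf_lower[OF _ bdd] that by (fastforce simp: u_def)
  qed
  then have "P u"
    using left[of u] \<open>P s\<close> \<open>s \<le> u\<close> \<open>u \<le> t\<close> by (cases "u = s") auto
  then have "u < t" using \<open>\<not> P t\<close> \<open>u \<le> t\<close> by (cases "u = t") auto
  then obtain b where b: "b > u" "\<And>v. \<lbrakk>u < v; v < b\<rbrakk> \<Longrightarrow> P v"
    using right[OF \<open>s \<le> u\<close> _ \<open>P u\<close>] by (auto simp: eventually_at_right_field)
  have "b \<le> v" if "v \<in> A" for v
  proof (rule ccontr)
    assume "\<not> b \<le> v"
    moreover have "u \<le> v" using cInf_lower[OF that bdd] by (simp add: u_def)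
    ultimately show False using b(2)[of v] \<open>P u\<close> that by (cases "u = v") (auto simp: A_def)
  qed
  then have "b \<le> u"
    unfolding u_def using \<open>t \<in> A\<close> by (intro cInf_greatest) auto
  then show False using b(1) by simp
qed

text \<open>Models one sample path, so that the relation between counts and configurations is proved
  without probability.\<close>

locale jump_path =
  fixes z :: "real \<Rightarrow> 'c" and E :: "'e set" and n :: "'e \<Rightarrow> real \<Rightarrow> nat" and act :: "'e \<Rightarrow> 'c \<Rightarrow> 'c"
  assumes z_right: "0 \<le> t \<Longrightarrow> \<forall>\<^sub>F s in at_right t. z s = z t"
    and n_right: "\<lbrakk>e \<in> E; 0 \<le> t\<rbrakk> \<Longrightarrow> \<forall>\<^sub>F s in at_right t. n e s = n e t"
    and n_mono: "e \<in> E \<Longrightarrow> mono_on {0..} (n e)"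
    and jump: "\<lbrakk>0 < t; e \<in> E; jump_time (n e) t\<rbrakk> \<Longrightarrow> \<forall>\<^sub>F s in at_left t. z t = act e (z s)"
    and no_jump: "\<lbrakk>0 < t; \<And>e. e \<in> E \<Longrightarrow> \<not> jump_time (n e) t\<rbrakk> \<Longrightarrow> \<forall>\<^sub>F s in at_left t. z t = z s"
begin

lemma left_value:
  assumes "\<forall>\<^sub>F v in at_left u. z u = f (z v)" "s < u" "\<And>v. \<lbrakk>s \<le> v; v < u\<rbrakk> \<Longrightarrow> z v = c"
  shows "z u = f c"
proof -
  have "\<forall>\<^sub>F v in at_left u. z v = c"
    using assms(2,3) by (auto simp: eventually_at_left_field intro!: exI[of _ s])
  then have "\<forall>\<^sub>F v in at_left u. z u = f c"
    using assms(1) by eventually_elim simp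
  \<comment> \<open>The claim no longer depends on \<open>v\<close>, and the filter
    \<open>at_left u\<close> is nontrivial.\<close>
  then show ?thesis by simp
qed

lemma eq_if_no_jump:
  assumes "0 \<le> s" "s \<le> t" and no: "\<And>e u. \<lbrakk>e \<in> E; s < u; u \<le> t\<rbrakk> \<Longrightarrow> \<not> jump_time (n e) u"
  shows "z t = z s"
proof (rule real_interval_induct[OF \<open>s \<le> t\<close>])
  fix u assume u: "s \<le> u" "u < t" "z u = z s"
  show "\<forall>\<^sub>F v in at_right u. z v = z s"
    using z_right[of u] u \<open>0 \<le> s\<close> by simp
next
  fix u assume u: "s < u" "u \<le> t" "\<And>v. \<lbrakk>s \<le> v; v < u\<rbrakk> \<Longrightarrow> z v = z s"
  have "\<forall>\<^sub>F v in at_left u. z u = z v"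
    using no u \<open>0 \<le> s\<close> by (intro no_jump) auto
  then show "z u = z s" using left_value[of u "\<lambda>c. c" s] u by blast
qed simp

text \<open>Continuous induction: at every time the left limit is still \<open>z s\<close>, and
  neither a jump nor its absence can change it, because all \<open>act e\<close> fix it.\<close>

lemma absorbed:
  assumes "0 \<le> s" "s \<le> t" and fixed: "\<And>e. e \<in> E \<Longrightarrow> act e (z s) = z s"
  shows "z t = z s"
proof (rule real_interval_induct[OF \<open>s \<le> t\<close>])
  fix u assume u: "s \<le> u" "u < t" "z u = z s"
  show "\<forall>\<^sub>F v in at_right u. z v = z s"
    using z_right[of u] u \<open>0 \<le> s\<close> by simp
next
  fix u assume u: "s < u" "u \<le> t" "\<And>v. \<lbrakk>s \<le> v; v < u\<rbrakk> \<Longrightarrow> z v = z s"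
  show "z u = z s"
  proof (cases "\<exists>e\<in>E. jump_time (n e) u")
    case True
    then obtain e where e: "e \<in> E" "jump_time (n e) u" by blast
    then have "\<forall>\<^sub>F v in at_left u. z u = act e (z v)"
      using u \<open>0 \<le> s\<close> by (intro jump) auto
    from left_value[OF this u(1,3)] show ?thesis using fixed e by simp
  next
    case False
    then have "\<forall>\<^sub>F v in at_left u. z u = z v"
      using u \<open>0 \<le> s\<close> by (intro no_jump) auto
    then show "z u = z s" using left_value[of u "\<lambda>c. c" s] u by blast
  qed
qed simp

lemma no_jump_if_count_eq:
  assumes "e \<in> E" "0 \<le> s" "s < u" "u \<le> t" "n e t = n e s"
  shows "\<not> jump_time (n e) u"
proof
  assume "jump_time (n e) u"
  then have "n e s < n e u" using assms by (simp add: jump_time_def)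
  also have "n e u \<le> n e t" using mono_onD[OF n_mono[OF \<open>e \<in> E\<close>], of u t] assms by simp
  finally show False using assms by simp
qed

text \<open>The jump sits at the infimum \<open>u\<close> of the times at which the count has its
  final value.\<close>

lemma unique_jump_if_count_Suc:
  assumes e: "e \<in> E" and "0 \<le> s" "s \<le> t" and Suc: "n e t = Suc (n e s)"
  obtains u where "s < u" "u \<le> t" "jump_time (n e) u"
    "\<And>v. \<lbrakk>s < v; v \<le> t; jump_time (n e) v\<rbrakk> \<Longrightarrow> v = u"
proof -
  have mono: "n e v \<le> n e w" if "0 \<le> v" "v \<le> w" for v w
    using n_mono[OF e] that by (auto simp: mono_on_def)
  define A where "A = {v. s \<le> v \<and> n e v = n e t}"
  define u where "u = Inf A"
  have "t \<in> A" and bdd: "bdd_below A"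
    using \<open>s \<le> t\<close> by (auto simp: A_def bdd_below_def)
  have "u \<le> t" unfolding u_def by (rule cInf_lower[OF \<open>t \<in> A\<close> bdd])
  have "s \<le> u" unfolding u_def using \<open>t \<in> A\<close> by (intro cInf_greatest) (auto simp: A_def)
  \<comment> \<open>No natural number lies strictly between \<open>n e s\<close> and its successor,
    so a count that has not reached its final value has not moved at all.\<close>
  have lower: "n e v = n e s" if "s \<le> v" "v < u" for v
  proof -
    have "v \<notin> A" using cInf_lower[OF _ bdd, of v] that by (auto simp: u_def)
    then have "n e v \<noteq> n e t" using that by (simp add: A_def)
    then show ?thesis
      using mono[of s v] mono[of v t] that \<open>u \<le> t\<close> \<open>0 \<le> s\<close> Suc by linarith
  qed
  \<comment> \<open>The infimum is attained: there are elements of \<open>A\<close> arbitrarily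
    close to \<open>u\<close> from the right, and there the count equals
    \<open>n e u\<close>.\<close>
  have nu: "n e u = n e t"
  proof -
    obtain b where b: "b > u" "\<And>v. \<lbrakk>u < v; v < b\<rbrakk> \<Longrightarrow> n e v = n e u"
      using n_right[OF e, of u] \<open>0 \<le> s\<close> \<open>s \<le> u\<close> by (auto simp: eventually_at_right_field)
    obtain v where "v \<in> A" "v < b"
      using b(1) cInf_lessD[of A b] \<open>t \<in> A\<close> by (auto simp: u_def)
    moreover have "u \<le> v" unfolding u_def by (rule cInf_lower[OF \<open>v \<in> A\<close> bdd])
    ultimately show ?thesis using b(2)[of v] by (cases "u = v") (auto simp: A_def)
  qed
  have "s < u" using nu Suc \<open>s \<le> u\<close> by (cases "s = u") auto
  have jump_u: "jump_time (n e) u"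
    unfolding jump_time_def
  proof (intro conjI allI impI)
    show "0 < u" using \<open>0 \<le> s\<close> \<open>s < u\<close> by simp
    fix v assume v: "0 \<le> v \<and> v < u"
    show "n e v < n e u"
      using lower[of v] mono[of v s] v nu Suc by (cases "s \<le> v") auto
  qed
  \<comment> \<open>A second jump would raise the count above \<open>n e t\<close>.\<close>
  have unique: "v = u" if v: "s < v" "v \<le> t" "jump_time (n e) v" for v
  proof (rule ccontr)
    assume "v \<noteq> u"
    have "n e s < n e v" using v \<open>0 \<le> s\<close> by (simp add: jump_time_def)
    then have "\<not> v < u" using lower[of v] v by auto
    then have "n e u < n e v" using v \<open>v \<noteq> u\<close> \<open>s < u\<close> \<open>0 \<le> s\<close> by (simp add: jump_time_def)
    then show False using nu mono[of v t] v \<open>0 \<le> s\<close> by simp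
  qed
  show ?thesis using unique by (rule that[OF \<open>s < u\<close> \<open>u \<le> t\<close> jump_u])
qed

lemma eq_if_counts_eq:
  assumes "0 \<le> s" "s \<le> t" "\<And>e. e \<in> E \<Longrightarrow> n e t = n e s"
  shows "z t = z s"
proof (rule eq_if_no_jump[OF assms(1,2)])
  fix e u assume "e \<in> E" "s < u" "u \<le> t"
  then show "\<not> jump_time (n e) u"
    using no_jump_if_count_eq assms(1) assms(3)[of e] by blast
qed

text \<open>The path is constant before the single jump, changes by \<open>act e\<close> there, and
  is constant afterwards.\<close>

lemma act_if_one_count_Suc:
  assumes "0 \<le> s" "s \<le> t" and e: "e \<in> E" "n e t = Suc (n e s)"
    and others: "\<And>e'. \<lbrakk>e' \<in> E; e' \<noteq> e\<rbrakk> \<Longrightarrow> n e' t = n e' s"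
  shows "z t = act e (z s)"
proof -
  obtain u where u: "s < u" "u \<le> t" "jump_time (n e) u"
      "\<And>v. \<lbrakk>s < v; v \<le> t; jump_time (n e) v\<rbrakk> \<Longrightarrow> v = u"
    by (rule unique_jump_if_count_Suc[OF e(1) assms(1,2) e(2)]) blast
  have only: "\<not> jump_time (n e') v" if "e' \<in> E" "s < v" "v \<le> t" "v \<noteq> u" for e' v
    using that u(4)[of v] others no_jump_if_count_eq[of e' s v t] \<open>0 \<le> s\<close> by (cases "e' = e") auto
  have before: "z v = z s" if "s \<le> v" "v < u" for v
    using that u(2) \<open>0 \<le> s\<close> by (intro eq_if_no_jump only) auto
  have "0 < u" using u(1) \<open>0 \<le> s\<close> by simp
  have "z u = act e (z s)"
    by (rule left_value[OF jump[OF \<open>0 < u\<close> e(1) u(3)] u(1) before])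
  moreover have "z t = z u"
    using u(1,2) \<open>0 \<le> s\<close> by (intro eq_if_no_jump only) auto
  ultimately show ?thesis by simp
qed

end

section \<open>Fixation\<close>

text \<open>The fixation time may be earlier than \<open>t\<close>, but by right-continuity the
  infimum that defines it already shows the final configuration.\<close>

lemma (in attraction_process) fixation_value:
  assumes "\<omega> \<in> space M" "0 \<le> t" and const: "\<And>s. t < s \<Longrightarrow> \<zeta> s \<omega> = \<zeta> t \<omega>"
  shows "fixation_time \<zeta> \<omega> < \<infinity>" and "\<zeta> (real_of_ereal (fixation_time \<zeta> \<omega>)) \<omega> = \<zeta> t \<omega>"
proof -
  define A where "A = {ereal t | t. 0 \<le> t \<and> (\<forall>s>t. \<zeta> t \<omega> = \<zeta> s \<omega>)}"
  have T: "fixation_time \<zeta> \<omega> = Inf A" by (simp add: fixation_time_def A_def)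
  have tA: "ereal t \<in> A" using const \<open>0 \<le> t\<close> by (auto simp: A_def)
  have le: "Inf A \<le> ereal t" by (rule Inf_lower[OF tA])
  have ge: "0 \<le> Inf A" by (rule Inf_greatest) (auto simp: A_def)
  obtain u where u: "Inf A = ereal u" "0 \<le> u"
    using le ge by (cases "Inf A") auto
  show "fixation_time \<zeta> \<omega> < \<infinity>" by (simp add: T u)
  obtain b where b: "b > u" "\<And>v. \<lbrakk>u < v; v < b\<rbrakk> \<Longrightarrow> \<zeta> v \<omega> = \<zeta> u \<omega>"
    using right_continuous[OF assms(1) u(2)] by (auto simp: eventually_at_right_field)
  have "Inf A < ereal b" using b(1) u by simp
  then obtain v where v: "v < b" "ereal v \<in> A" "0 \<le> v" "\<And>s. v < s \<Longrightarrow> \<zeta> v \<omega> = \<zeta> s \<omega>"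
    unfolding Inf_less_iff by (auto simp: A_def)
  have "u \<le> v" using Inf_lower[OF v(2)] u by simp
  then have "\<zeta> u \<omega> = \<zeta> v \<omega>" using b(2)[of v] v(1) by (cases "u = v") auto
  \<comment> \<open>A time beyond both \<open>v\<close> and \<open>t\<close> links the two constant
    tails.\<close>
  also have "\<dots> = \<zeta> (max v t + 1) \<omega>" by (rule v(4)) simp
  also have "\<dots> = \<zeta> t \<omega>" by (rule const) simp
  finally show "\<zeta> (real_of_ereal (fixation_time \<zeta> \<omega>)) \<omega> = \<zeta> t \<omega>" by (simp add: T u)
qed

text \<open>Eliminates the fixation time: any time after which nothing changes can take its
  place.\<close>

lemma (in attraction_process) in_consensus_event_iff:
  assumes "\<omega> \<in> space M"
  shows "\<omega> \<in> consensus_event M G S \<zeta> \<longleftrightarrow>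
    (\<exists>t\<ge>0. (\<forall>s>t. \<zeta> s \<omega> = \<zeta> t \<omega>) \<and> (\<exists>c\<in>pverts G. \<forall>x\<in>pverts S. \<zeta> t \<omega> x = c))"
    (is "?L \<longleftrightarrow> ?R")
proof
  assume ?L
  then have fin: "fixation_time \<zeta> \<omega> < \<infinity>"
    and c: "\<exists>c\<in>pverts G. \<forall>x\<in>pverts S. \<zeta> (real_of_ereal (fixation_time \<zeta> \<omega>)) \<omega> x = c"
    by (auto simp: consensus_event_def)
  \<comment> \<open>The infimum of the empty set is infinite.\<close>
  from fin have "{ereal t | t. 0 \<le> t \<and> (\<forall>s>t. \<zeta> t \<omega> = \<zeta> s \<omega>)} \<noteq> {}"
    unfolding fixation_time_def by (metis Inf_empty top_ereal_def less_irrefl)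
  then obtain t where t: "0 \<le> t" "\<And>s. t < s \<Longrightarrow> \<zeta> s \<omega> = \<zeta> t \<omega>"
    by fastforce
  then show ?R using c fixation_value(2)[OF assms t] by auto
next
  assume ?R
  then obtain t where "0 \<le> t" "\<And>s. t < s \<Longrightarrow> \<zeta> s \<omega> = \<zeta> t \<omega>"
    "\<exists>c\<in>pverts G. \<forall>x\<in>pverts S. \<zeta> t \<omega> x = c" by auto
  then show ?L
    using fixation_value[OF assms, of t] assms by (simp add: consensus_event_def)
qed

text \<open>
  The measure of a non-measurable set is 0, so a lower bound requires the consensus event to be
  measurable; right-continuity reduces it to countably many times.
\<close>

lemma (in attraction_process) in_consensus_event_iff_rational:
  assumes "\<omega> \<in> space M"
  shows "\<omega> \<in> consensus_event M G S \<zeta> \<longleftrightarrow>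
    (\<exists>q\<in>{q\<in>\<rat>. 0 \<le> q}. (\<forall>s\<in>{s\<in>\<rat>. q < s}. \<zeta> s \<omega> = \<zeta> q \<omega>) \<and> (\<exists>c\<in>pverts G. \<forall>x\<in>pverts S. \<zeta> q \<omega> x = c))"
    (is "_ \<longleftrightarrow> ?R")
  unfolding in_consensus_event_iff[OF assms]
proof
  assume "\<exists>t\<ge>0. (\<forall>s>t. \<zeta> s \<omega> = \<zeta> t \<omega>) \<and> (\<exists>c\<in>pverts G. \<forall>x\<in>pverts S. \<zeta> t \<omega> x = c)"
  then obtain t where t: "0 \<le> t" "\<And>s. t < s \<Longrightarrow> \<zeta> s \<omega> = \<zeta> t \<omega>"
    "\<exists>c\<in>pverts G. \<forall>x\<in>pverts S. \<zeta> t \<omega> x = c" by auto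
  obtain q where q: "q \<in> \<rat>" "t < q" using Rats_dense_in_real[of t "t + 1"] by auto
  show ?R using t q by (intro bexI[of _ q]) auto
next
  assume ?R
  then obtain q where q: "q \<in> \<rat>" "0 \<le> q" "\<And>s. \<lbrakk>s \<in> \<rat>; q < s\<rbrakk> \<Longrightarrow> \<zeta> s \<omega> = \<zeta> q \<omega>"
    "\<exists>c\<in>pverts G. \<forall>x\<in>pverts S. \<zeta> q \<omega> x = c" by auto
  have "\<zeta> s \<omega> = \<zeta> q \<omega>" if "q < s" for s
  proof -
    have "0 \<le> s" using that q(2) by simp
    then obtain b where b: "b > s" "\<And>v. \<lbrakk>s < v; v < b\<rbrakk> \<Longrightarrow> \<zeta> v \<omega> = \<zeta> s \<omega>"
      using right_continuous[OF assms, of s] by (auto simp: eventually_at_right_field)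
    obtain v where "v \<in> \<rat>" "s < v" "v < b" using Rats_dense_in_real[OF b(1)] by auto
    then show ?thesis using b(2)[of v] q(3)[of v] that by auto
  qed
  then show "\<exists>t\<ge>0. (\<forall>s>t. \<zeta> s \<omega> = \<zeta> t \<omega>) \<and> (\<exists>c\<in>pverts G. \<forall>x\<in>pverts S. \<zeta> t \<omega> x = c)"
    using q by blast
qed

text \<open>With countably many configurations, a joint condition is a countable union over the
  pairs of values that satisfy it.\<close>

lemma (in attraction_process) process_event:
  assumes "countable (pverts S \<rightarrow>\<^sub>E pverts G)" "0 \<le> s" "0 \<le> t"
  shows "{\<omega> \<in> space M. P (\<zeta> s \<omega>) (\<zeta> t \<omega>)} \<in> events"
proof -
  let ?C = "pverts S \<rightarrow>\<^sub>E pverts G"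
  have ev: "\<zeta> u -` {f} \<inter> space M \<in> events" if "0 \<le> u" "f \<in> ?C" for u f
    using measurable_sets[OF process_measurable[OF that(1)], of "{f}"] that by simp
  have "{\<omega> \<in> space M. P (\<zeta> s \<omega>) (\<zeta> t \<omega>)} =
      (\<Union>fg\<in>{fg\<in>?C \<times> ?C. P (fst fg) (snd fg)}. (\<zeta> s -` {fst fg} \<inter> space M) \<inter> (\<zeta> t -` {snd fg} \<inter> space M))"
    using measurable_space[OF process_measurable[OF assms(2)]]
      measurable_space[OF process_measurable[OF assms(3)]] by auto
  also have "\<dots> \<in> events"
    using assms by (intro sets.countable_UN') (auto intro!: sets.Int ev)
  finally show ?thesis .
qed

lemma (in attraction_process) consensus_event_measurable:
  assumes "countable (pverts S \<rightarrow>\<^sub>E pverts G)"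
  shows "consensus_event M G S \<zeta> \<in> events"
proof -
  have "consensus_event M G S \<zeta> = {\<omega> \<in> space M. \<exists>q\<in>{q\<in>\<rat>. 0 \<le> q}.
      (\<forall>s\<in>{s\<in>\<rat>. q < s}. \<zeta> s \<omega> = \<zeta> q \<omega>) \<and> (\<exists>c\<in>pverts G. \<forall>x\<in>pverts S. \<zeta> q \<omega> x = c)}"
    (is "_ = ?R")
  proof (intro set_eqI)
    fix \<omega>
    have "consensus_event M G S \<zeta> \<subseteq> space M" by (auto simp: consensus_event_def)
    then show "\<omega> \<in> consensus_event M G S \<zeta> \<longleftrightarrow> \<omega> \<in> ?R"
      using in_consensus_event_iff_rational[of \<omega>] by (cases "\<omega> \<in> space M") auto
  qed
  also have "\<dots> \<in> events"
  proof (rule sets.sets_Collect_countable_Ex')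
    fix q :: real assume q: "q \<in> {q \<in> \<rat>. 0 \<le> q}"
    have "{\<omega> \<in> space M. \<forall>s\<in>{s \<in> \<rat>. q < s}. \<zeta> s \<omega> = \<zeta> q \<omega>} \<in> events"
      using process_event[OF assms, of _ q "\<lambda>f g. f = g"] q
      by (intro sets.sets_Collect_countable_All' countable_Collect countable_rat) auto
    moreover have "{\<omega> \<in> space M. \<exists>c\<in>pverts G. \<forall>x\<in>pverts S. \<zeta> q \<omega> x = c} \<in> events"
      using process_event[OF assms, of q q "\<lambda>f g. \<exists>c\<in>pverts G. \<forall>x\<in>pverts S. f x = c"] q
      by simp
    ultimately show "{\<omega> \<in> space M. (\<forall>s\<in>{s \<in> \<rat>. q < s}. \<zeta> s \<omega> = \<zeta> q \<omega>) \<and>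
        (\<exists>c\<in>pverts G. \<forall>x\<in>pverts S. \<zeta> q \<omega> x = c)} \<in> events"
      by (intro sets.sets_Collect_conj)
  qed (intro countable_Collect countable_rat)
  finally show ?thesis .
qed

section \<open>Chains driven by independent events\<close>

text \<open>
  A chain that starts at \<open>X\<close> and applies \<open>act e\<close> in step \<open>k\<close> on the event \<open>A e k\<close>, and that stays put
  off all these events. Only the joint probabilities of the events \<open>A e k\<close> with the start are
  prescribed; nothing is assumed about their complements.
\<close>

locale driven_chain = prob_space M for M :: "'w measure" +
  fixes X :: "'w \<Rightarrow> 'c" and C :: "'c set" and E :: "'e set" and act :: "'e \<Rightarrow> 'c \<Rightarrow> 'c"
    and A :: "'e \<Rightarrow> nat \<Rightarrow> 'w set" and p :: real
  assumes finite_C: "finite C" and finite_E: "finite E"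
    and X_measurable: "X \<in> measurable M (count_space C)"
    and act_closed: "\<lbrakk>e \<in> E; c \<in> C\<rbrakk> \<Longrightarrow> act e c \<in> C"
    and A_events: "e \<in> E \<Longrightarrow> A e k \<in> events"
    and A_disjoint: "\<lbrakk>e \<in> E; e' \<in> E; e \<noteq> e'\<rbrakk> \<Longrightarrow> A e k \<inter> A e' k = {}"
    and A_independent:
      "\<lbrakk>c \<in> C; finite J; \<And>j. j \<in> J \<Longrightarrow> w j \<in> E\<rbrakk> \<Longrightarrow>
        prob {\<omega> \<in> space M. X \<omega> = c \<and> (\<forall>j\<in>J. \<omega> \<in> A (w j) j)} = prob {\<omega> \<in> space M. X \<omega> = c} * p ^ card J"
begin

text \<open>By \<open>A_disjoint\<close> at most one index qualifies in each step, so
  \<open>SOME\<close> selects it unambiguously.\<close>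

primrec Y :: "nat \<Rightarrow> 'w \<Rightarrow> 'c" where
  "Y 0 \<omega> = X \<omega>"
| "Y (Suc k) \<omega> = (if \<exists>e\<in>E. \<omega> \<in> A e k then act (SOME e. e \<in> E \<and> \<omega> \<in> A e k) (Y k \<omega>) else Y k \<omega>)"

lemma Y_Suc_act: "\<lbrakk>e \<in> E; \<omega> \<in> A e k\<rbrakk> \<Longrightarrow> Y (Suc k) \<omega> = act e (Y k \<omega>)"
proof -
  assume e: "e \<in> E" "\<omega> \<in> A e k"
  have "(SOME e. e \<in> E \<and> \<omega> \<in> A e k) = e"
    using e A_disjoint by (intro some_equality) auto
  then show ?thesis using e by auto
qed

lemma Y_Suc_stay: "(\<And>e. e \<in> E \<Longrightarrow> \<omega> \<notin> A e k) \<Longrightarrow> Y (Suc k) \<omega> = Y k \<omega>"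
  by auto

declare Y.simps(2) [simp del]

lemma Y_measurable: "Y k \<in> measurable M (count_space C)"
proof (induction k)
  case 0
  have "Y 0 = X" by auto
  then show ?case using X_measurable by simp
next
  case (Suc k)
  have ev: "{\<omega> \<in> space M. Q (Y k \<omega>)} \<in> events" for Q
    using measurable_sets[OF Suc, of "C \<inter> {c. Q c}"] measurable_space[OF Suc]
    by (auto simp: vimage_def Int_def conj_commute cong: conj_cong)
  have "Y (Suc k) -` {c} \<inter> space M =
      (\<Union>e\<in>E. A e k \<inter> {\<omega> \<in> space M. act e (Y k \<omega>) = c}) \<union> ({\<omega> \<in> space M. Y k \<omega> = c} - (\<Union>e\<in>E. A e k))" for c
  proof (intro set_eqI)
    fix \<omega>
    show "\<omega> \<in> Y (Suc k) -` {c} \<inter> space M \<longleftrightarrow> \<omega> \<in>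
      (\<Union>e\<in>E. A e k \<inter> {\<omega> \<in> space M. act e (Y k \<omega>) = c}) \<union> ({\<omega> \<in> space M. Y k \<omega> = c} - (\<Union>e\<in>E. A e k))"
      
    proof (cases "\<exists>e\<in>E. \<omega> \<in> A e k")
      case True
      then obtain e where e: "e \<in> E" "\<omega> \<in> A e k" by blast
      then have "\<omega> \<in> A e' k \<longleftrightarrow> e' = e" if "e' \<in> E" for e'
        using A_disjoint[of e e' k] that by blast
      then show ?thesis using e by (auto simp: Y_Suc_act)
    qed (auto simp: Y_Suc_stay)
  qed
  moreover have "(\<Union>e\<in>E. A e k \<inter> {\<omega> \<in> space M. act e (Y k \<omega>) = c}) \<union> ({\<omega> \<in> space M. Y k \<omega> = c} - (\<Union>e\<in>E. A e k)) \<in> events" for c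
    using finite_E A_events ev by (intro sets.Un sets.Diff sets.finite_UN sets.Int) auto
  moreover have "Y (Suc k) \<omega> \<in> C" if "\<omega> \<in> space M" for \<omega>
    using measurable_space[OF Suc that] act_closed
    by (cases "\<exists>e\<in>E. \<omega> \<in> A e k") (auto simp: Y_Suc_act Y_Suc_stay)
  ultimately show ?case by (auto simp: measurable_count_space_eq2[OF finite_C])
qed

lemma Y_in: "\<omega> \<in> space M \<Longrightarrow> Y k \<omega> \<in> C"
  using measurable_space[OF Y_measurable] by simp

lemma Y_event: "{\<omega> \<in> space M. Q (Y k \<omega>)} \<in> events"
proof -
  have "{\<omega> \<in> space M. Q (Y k \<omega>)} = Y k -` (C \<inter> {c. Q c}) \<inter> space M" using Y_in by auto
  then show ?thesis using measurable_sets[OF Y_measurable, of "C \<inter> {c. Q c}"] by simp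
qed

lemma integrable_Y [simp]: "integrable M (\<lambda>\<omega>. F (Y k \<omega>) :: real)"
proof (rule integrable_const_bound[where B = "Max ((\<lambda>c. \<bar>F c\<bar>) ` C)"])
  show "AE \<omega> in M. norm (F (Y k \<omega>)) \<le> Max ((\<lambda>c. \<bar>F c\<bar>) ` C)"
    using Y_in finite_C by (intro AE_I2) simp
  show "(\<lambda>\<omega>. F (Y k \<omega>)) \<in> borel_measurable M"
    by (rule measurable_compose[OF Y_measurable]) simp
qed

text \<open>Cylinder events that only prescribe occurrences, matching \<open>A_independent\<close>;
  complements never enter.\<close>

definition hits :: "nat set \<Rightarrow> (nat \<Rightarrow> 'e) \<Rightarrow> 'w set" where
  "hits J w = {\<omega> \<in> space M. \<forall>j\<in>J. \<omega> \<in> A (w j) j}"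

lemma hits_events:
  assumes "finite J" "\<And>j. j \<in> J \<Longrightarrow> w j \<in> E"
  shows "hits J w \<in> events"
proof -
  have "{\<omega> \<in> space M. \<omega> \<in> A (w j) j} = A (w j) j" if "j \<in> J" for j
    using sets.sets_into_space[OF A_events[OF assms(2)[OF that]]] by blast
  then show ?thesis
    unfolding hits_def using assms A_events by (intro sets.sets_Collect_finite_All) auto
qed

lemma integrable_Y_indicator [simp]:
  assumes "finite J" "\<And>j. j \<in> J \<Longrightarrow> w j \<in> E"
  shows "integrable M (\<lambda>\<omega>. F (Y k \<omega>) * indicator (hits J w) \<omega> :: real)"
  using integrable_real_mult_indicator[OF hits_events[of J w] integrable_Y] assms by simp

text \<open>Disjointness leaves at most one nonzero summand. The step thereby becomes linear in the
  indicators of the events \<open>A e k\<close>, with no term for staying put.\<close>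

lemma Y_increment:
  fixes F :: "'c \<Rightarrow> real"
  shows "F (Y (Suc k) \<omega>) = F (Y k \<omega>) + (\<Sum>e\<in>E. (F (act e (Y k \<omega>)) - F (Y k \<omega>)) * indicator (A e k) \<omega>)"
proof (cases "\<exists>e\<in>E. \<omega> \<in> A e k")
  case True
  then obtain e where e: "e \<in> E" "\<omega> \<in> A e k" by blast
  have "(\<Sum>e\<in>E. (F (act e (Y k \<omega>)) - F (Y k \<omega>)) * indicator (A e k) \<omega>) =
      (\<Sum>e'\<in>E. if e' = e then F (act e (Y k \<omega>)) - F (Y k \<omega>) else 0)"
    using e A_disjoint by (intro sum.cong) (auto simp: indicator_def)
  then show ?thesis using e finite_E by (simp add: Y_Suc_act)
next
  case False
  then show ?thesis by (simp add: Y_Suc_stay)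
qed

text \<open>Since \<open>k\<close> is not in \<open>J\<close>, multiplying the indicator of
  \<open>A e k\<close> by that of \<open>hits J w\<close> gives a larger cylinder. The factorization
  at time \<open>k\<close> is a hypothesis, so that the induction hypothesis of
  \<open>expectation_indep\<close> can supply it.\<close>

lemma expectation_Suc_on_hits:
  fixes F :: "'c \<Rightarrow> real"
  assumes "finite J" "\<And>j. j \<in> J \<Longrightarrow> w j \<in> E" "k \<notin> J"
    and indep: "\<And>F e. e \<in> E \<Longrightarrow>
      expectation (\<lambda>\<omega>. F (Y k \<omega>) * indicator (hits (insert k J) (w(k := e))) \<omega>) = expectation (\<lambda>\<omega>. F (Y k \<omega>)) * p ^ Suc (card J)"
  shows "expectation (\<lambda>\<omega>. F (Y (Suc k) \<omega>) * indicator (hits J w) \<omega>) =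
    expectation (\<lambda>\<omega>. F (Y k \<omega>) * indicator (hits J w) \<omega>) +
    expectation (\<lambda>\<omega>. \<Sum>e\<in>E. F (act e (Y k \<omega>)) - F (Y k \<omega>)) * p ^ Suc (card J)"
proof -
  have w: "\<And>j. j \<in> insert k J \<Longrightarrow> (w(k := e)) j \<in> E" if "e \<in> E" for e using assms(2) that by auto
  let ?D = "\<lambda>e c. F (act e c) - F c"
  have int: "integrable M (\<lambda>\<omega>. ?D e (Y k \<omega>) * indicator (hits (insert k J) (w(k := e))) \<omega>)" if "e \<in> E" for e
    using integrable_Y_indicator[where F = "?D e" and J = "insert k J" and w = "w(k := e)" and k = k] w[OF that] \<open>finite J\<close> by simp
  have "F (Y (Suc k) \<omega>) * indicator (hits J w) \<omega> = F (Y k \<omega>) * indicator (hits J w) \<omega> +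
      (\<Sum>e\<in>E. ?D e (Y k \<omega>) * indicator (hits (insert k J) (w(k := e))) \<omega>)" if "\<omega> \<in> space M" for \<omega>
  proof -
    have "indicator (A e k) \<omega> * indicator (hits J w) \<omega> = (indicator (hits (insert k J) (w(k := e))) \<omega> :: real)" for e
      using that \<open>k \<notin> J\<close> by (auto simp: indicator_def hits_def)
    then show ?thesis
      by (simp add: Y_increment distrib_right sum_distrib_right mult.assoc)
  qed
  then have "expectation (\<lambda>\<omega>. F (Y (Suc k) \<omega>) * indicator (hits J w) \<omega>) =
      expectation (\<lambda>\<omega>. F (Y k \<omega>) * indicator (hits J w) \<omega> +
      (\<Sum>e\<in>E. ?D e (Y k \<omega>) * indicator (hits (insert k J) (w(k := e))) \<omega>))"
    by (intro Bochner_Integration.integral_cong) auto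
  also have "\<dots> = expectation (\<lambda>\<omega>. F (Y k \<omega>) * indicator (hits J w) \<omega>) +
      (\<Sum>e\<in>E. expectation (\<lambda>\<omega>. ?D e (Y k \<omega>) * indicator (hits (insert k J) (w(k := e))) \<omega>))"
    using assms(1,2) int by (simp add: Bochner_Integration.integral_sum)
  also have "(\<Sum>e\<in>E. expectation (\<lambda>\<omega>. ?D e (Y k \<omega>) * indicator (hits (insert k J) (w(k := e))) \<omega>)) =
      (\<Sum>e\<in>E. expectation (\<lambda>\<omega>. ?D e (Y k \<omega>)) * p ^ Suc (card J))"
    using indep[of _ "?D _"] by (intro sum.cong) auto
  also have "\<dots> = expectation (\<lambda>\<omega>. \<Sum>e\<in>E. ?D e (Y k \<omega>)) * p ^ Suc (card J)"
    using integrable_Y[of "?D _" k] by (simp add: Bochner_Integration.integral_sum sum_distrib_right)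
  finally show ?thesis .
qed

text \<open>The state at time \<open>k\<close> is independent of the events from step
  \<open>k\<close> on. The induction generalizes \<open>F\<close>, \<open>J\<close> and
  \<open>w\<close>, because a step back adds \<open>k\<close> to \<open>J\<close> and replaces
  \<open>F\<close> by its increments.\<close>

lemma expectation_indep:
  fixes F :: "'c \<Rightarrow> real"
  assumes "finite J" "\<And>j. j \<in> J \<Longrightarrow> w j \<in> E" "J \<subseteq> {k..}"
  shows "expectation (\<lambda>\<omega>. F (Y k \<omega>) * indicator (hits J w) \<omega>) = expectation (\<lambda>\<omega>. F (Y k \<omega>)) * p ^ card J"
  using assms
proof (induction k arbitrary: F J w)
  case 0
  have XC: "X \<omega> \<in> C" if "\<omega> \<in> space M" for \<omega> using Y_in[OF that, of 0] by simp
  have eq: "expectation (\<lambda>\<omega>. F (X \<omega>) * indicator (hits J w) \<omega>) =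
      (\<Sum>c\<in>C. F c * prob {\<omega> \<in> space M. X \<omega> = c \<and> (\<forall>j\<in>J. \<omega> \<in> A (w j) j)})"
    if J: "finite J" "\<And>j. j \<in> J \<Longrightarrow> w j \<in> E" for J w
  proof -
    have ev: "{\<omega> \<in> space M. X \<omega> = c \<and> (\<forall>j\<in>J. \<omega> \<in> A (w j) j)} \<in> events" for c
    proof -
      have "{\<omega> \<in> space M. X \<omega> = c \<and> (\<forall>j\<in>J. \<omega> \<in> A (w j) j)} = {\<omega> \<in> space M. Y 0 \<omega> = c} \<inter> hits J w"
        by (auto simp: hits_def)
      then show ?thesis using Y_event[of "\<lambda>x. x = c" 0] hits_events[of J w] J by auto
    qed
    have "expectation (\<lambda>\<omega>. F (X \<omega>) * indicator (hits J w) \<omega>) =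
      expectation (\<lambda>\<omega>. \<Sum>c\<in>C. F c * indicator {\<omega> \<in> space M. X \<omega> = c \<and> (\<forall>j\<in>J. \<omega> \<in> A (w j) j)} \<omega>)"
    proof (intro Bochner_Integration.integral_cong refl)
      fix \<omega> assume \<omega>: "\<omega> \<in> space M"
      have "(\<Sum>c\<in>C. F c * indicator {\<omega> \<in> space M. X \<omega> = c \<and> (\<forall>j\<in>J. \<omega> \<in> A (w j) j)} \<omega>) =
          (\<Sum>c\<in>C. if c = X \<omega> then F c * indicator (hits J w) \<omega> else 0)"
        using \<omega> by (intro sum.cong) (auto simp: indicator_def hits_def)
      then show "F (X \<omega>) * indicator (hits J w) \<omega> =
          (\<Sum>c\<in>C. F c * indicator {\<omega> \<in> space M. X \<omega> = c \<and> (\<forall>j\<in>J. \<omega> \<in> A (w j) j)} \<omega>)"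
        using XC[OF \<omega>] finite_C by simp
    qed
    also have "\<dots> = (\<Sum>c\<in>C. F c * prob {\<omega> \<in> space M. X \<omega> = c \<and> (\<forall>j\<in>J. \<omega> \<in> A (w j) j)})"
      using ev by (subst Bochner_Integration.integral_sum) (auto simp: less_top[symmetric])
    finally show ?thesis .
  qed
  have "hits {} w = space M" by (simp add: hits_def)
  then have "expectation (\<lambda>\<omega>. F (X \<omega>)) = expectation (\<lambda>\<omega>. F (X \<omega>) * indicator (hits {} w) \<omega>)"
    by (intro Bochner_Integration.integral_cong) auto
  also have "\<dots> = (\<Sum>c\<in>C. F c * prob {\<omega> \<in> space M. X \<omega> = c})"
    using eq[of "{}"] by simp
  finally show ?case
    using eq[of J w] 0 by (simp add: A_independent sum_distrib_right mult.assoc)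
next
  case (Suc k)
  have w: "(w(k := e)) j \<in> E" if "e \<in> E" "j \<in> insert k J" for e j using Suc.prems(2) that by auto
  have kJ: "k \<notin> J" "J \<subseteq> {k..}" "insert k J \<subseteq> {k..}" using Suc.prems(3) by auto
  let ?D = "expectation (\<lambda>\<omega>. \<Sum>e\<in>E. F (act e (Y k \<omega>)) - F (Y k \<omega>))"
  have 1: "expectation (\<lambda>\<omega>. F (Y (Suc k) \<omega>) * indicator (hits J w) \<omega>) =
    expectation (\<lambda>\<omega>. F (Y k \<omega>) * indicator (hits J w) \<omega>) + ?D * p ^ Suc (card J)"
  proof (rule expectation_Suc_on_hits)
    show "expectation (\<lambda>\<omega>. F (Y k \<omega>) * indicator (hits (insert k J) (w(k := e))) \<omega>) =
        expectation (\<lambda>\<omega>. F (Y k \<omega>)) * p ^ Suc (card J)" if "e \<in> E" for F e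
      by (rule trans[OF Suc.IH[of "insert k J" "w(k := e)" F]]) (use w[OF that] Suc.prems(1) kJ in auto)
  qed (use Suc.prems(1,2) kJ in auto)
  have 2: "expectation (\<lambda>\<omega>. F (Y k \<omega>) * indicator (hits J w) \<omega>) = expectation (\<lambda>\<omega>. F (Y k \<omega>)) * p ^ card J"
    using Suc.prems kJ by (intro Suc.IH) auto
  have hits_empty: "hits {} w = space M" for w by (simp add: hits_def)
  \<comment> \<open>The same recursion without prescribed hits; compared with \<open>1\<close> and
    \<open>2\<close>, it lacks exactly the common factor \<open>p ^ card J\<close>.\<close>
  have "expectation (\<lambda>\<omega>. F (Y (Suc k) \<omega>) * indicator (hits {} w) \<omega>) =
    expectation (\<lambda>\<omega>. F (Y k \<omega>) * indicator (hits {} w) \<omega>) + ?D * p ^ Suc (card ({} :: nat set))"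
  proof (rule expectation_Suc_on_hits)
    show "expectation (\<lambda>\<omega>. F (Y k \<omega>) * indicator (hits {k} (w(k := e))) \<omega>) =
        expectation (\<lambda>\<omega>. F (Y k \<omega>)) * p ^ Suc (card ({} :: nat set))" if "e \<in> E" for F e
      by (rule trans[OF Suc.IH[of "{k}" "w(k := e)" F]]) (use that in auto)
  qed auto
  then have 3: "expectation (\<lambda>\<omega>. F (Y (Suc k) \<omega>)) = expectation (\<lambda>\<omega>. F (Y k \<omega>)) + ?D * p"
    unfolding hits_empty by (simp cong: Bochner_Integration.integral_cong)
  show ?case unfolding 1 2 3 by (simp add: algebra_simps)
qed

text \<open>The generator formula of the chain: every index acts with the same weight
  \<open>p\<close>.\<close>

lemma expectation_Suc:
  fixes F :: "'c \<Rightarrow> real"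
  shows "expectation (\<lambda>\<omega>. F (Y (Suc k) \<omega>)) =
    expectation (\<lambda>\<omega>. F (Y k \<omega>)) + p * expectation (\<lambda>\<omega>. \<Sum>e\<in>E. F (act e (Y k \<omega>)) - F (Y k \<omega>))"
proof -
  have hits_empty: "hits {} w = space M" for w by (simp add: hits_def)
  have "expectation (\<lambda>\<omega>. F (Y (Suc k) \<omega>) * indicator (hits {} w) \<omega>) =
    expectation (\<lambda>\<omega>. F (Y k \<omega>) * indicator (hits {} w) \<omega>) +
    expectation (\<lambda>\<omega>. \<Sum>e\<in>E. F (act e (Y k \<omega>)) - F (Y k \<omega>)) * p ^ Suc (card ({} :: nat set))" for w
  proof (rule expectation_Suc_on_hits)
    show "expectation (\<lambda>\<omega>. F (Y k \<omega>) * indicator (hits {k} (w(k := e))) \<omega>) =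
        expectation (\<lambda>\<omega>. F (Y k \<omega>)) * p ^ Suc (card ({} :: nat set))" if "e \<in> E" for F e
      by (rule trans[OF expectation_indep[of "{k}" "w(k := e)" k F]]) (use that in auto)
  qed auto
  then show ?thesis
    unfolding hits_empty by (simp cong: Bochner_Integration.integral_cong)
qed

section \<open>Consequences of a drift condition\<close>

lemma supermartingale:
  fixes F :: "'c \<Rightarrow> real"
  assumes "0 \<le> p" and drift: "\<And>c. c \<in> C \<Longrightarrow> (\<Sum>e\<in>E. F (act e c) - F c) \<le> 0"
  shows "expectation (\<lambda>\<omega>. F (Y k \<omega>)) \<le> expectation (\<lambda>\<omega>. F (X \<omega>))"
proof (induction k)
  case (Suc k)
  have "expectation (\<lambda>\<omega>. \<Sum>e\<in>E. F (act e (Y k \<omega>)) - F (Y k \<omega>)) \<le> expectation (\<lambda>\<omega>. 0)"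
    using drift Y_in integrable_Y[of "\<lambda>c. \<Sum>e\<in>E. F (act e c) - F c" k]
    by (intro integral_mono) auto
  then have "p * expectation (\<lambda>\<omega>. \<Sum>e\<in>E. F (act e (Y k \<omega>)) - F (Y k \<omega>)) \<le> 0"
    using \<open>0 \<le> p\<close> by (simp add: mult_nonneg_nonpos)
  then show ?case using Suc expectation_Suc[of F k] by linarith
qed simp

text \<open>Each step lowers the expectation of \<open>F\<close> by at least \<open>p\<close> times
  the probability of being active. This probability decreases in time, and the total decrease cannot
  exceed \<open>b\<close>.\<close>

lemma active_prob_bound:
  fixes F :: "'c \<Rightarrow> real"
  assumes "0 \<le> p"
    and nonneg: "\<And>c. c \<in> C \<Longrightarrow> 0 \<le> F c" and bound: "\<And>c. c \<in> C \<Longrightarrow> F c \<le> b"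
    and drift: "\<And>c. \<lbrakk>c \<in> C; active c\<rbrakk> \<Longrightarrow> (\<Sum>e\<in>E. F (act e c) - F c) \<le> -1"
    and frozen: "\<And>c e. \<lbrakk>c \<in> C; \<not> active c; e \<in> E\<rbrakk> \<Longrightarrow> act e c = c"
  shows "real m * p * prob {\<omega> \<in> space M. active (Y m \<omega>)} \<le> b"
proof -
  let ?a = "\<lambda>k. prob {\<omega> \<in> space M. active (Y k \<omega>)}"
  have "{\<omega> \<in> space M. active (Y (Suc k) \<omega>)} \<subseteq> {\<omega> \<in> space M. active (Y k \<omega>)}" for k
  proof safe
    fix \<omega> assume "\<omega> \<in> space M" "active (Y (Suc k) \<omega>)"
    show "active (Y k \<omega>)"
    proof (rule ccontr)
      assume "\<not> active (Y k \<omega>)"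
      then have "Y (Suc k) \<omega> = Y k \<omega>"
        using frozen Y_in[OF \<open>\<omega> \<in> space M\<close>]
        by (cases "\<exists>e\<in>E. \<omega> \<in> A e k") (auto simp: Y_Suc_act Y_Suc_stay)
      then show False using \<open>active (Y (Suc k) \<omega>)\<close> \<open>\<not> active (Y k \<omega>)\<close> by simp
    qed
  qed
  then have decr: "?a (Suc k) \<le> ?a k" for k by (intro finite_measure_mono Y_event)
  have mono: "?a m \<le> ?a k" if "k \<le> m" for k
    using decr by (rule lift_Suc_antimono_le[OF _ that])
  have step: "expectation (\<lambda>\<omega>. F (Y (Suc k) \<omega>)) \<le> expectation (\<lambda>\<omega>. F (Y k \<omega>)) - p * ?a k" for k
  proof -
    have "expectation (\<lambda>\<omega>. \<Sum>e\<in>E. F (act e (Y k \<omega>)) - F (Y k \<omega>)) \<le>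
        expectation (\<lambda>\<omega>. - indicator {\<omega> \<in> space M. active (Y k \<omega>)} \<omega>)"
    proof (rule integral_mono)
      show "integrable M (\<lambda>\<omega>. \<Sum>e\<in>E. F (act e (Y k \<omega>)) - F (Y k \<omega>))"
        by (rule integrable_Y)
      show "integrable M (\<lambda>\<omega>. - indicator {\<omega> \<in> space M. active (Y k \<omega>)} \<omega> :: real)"
        using Y_event[of active k] by (simp add: less_top[symmetric])
      show "(\<Sum>e\<in>E. F (act e (Y k \<omega>)) - F (Y k \<omega>)) \<le> - indicator {\<omega> \<in> space M. active (Y k \<omega>)} \<omega>"
        if "\<omega> \<in> space M" for \<omega>
        using drift[OF Y_in[OF that]] frozen[OF Y_in[OF that]] that
        by (cases "active (Y k \<omega>)") auto
    qed
    also have "\<dots> = - ?a k" using Y_event[of active k] by simp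
    finally have "p * expectation (\<lambda>\<omega>. \<Sum>e\<in>E. F (act e (Y k \<omega>)) - F (Y k \<omega>)) \<le> p * (- ?a k)"
      using \<open>0 \<le> p\<close> by (rule mult_left_mono)
    then show ?thesis using expectation_Suc[of F k] by simp
  qed
  have "expectation (\<lambda>\<omega>. F (Y k \<omega>)) \<le> b - real k * p * ?a m" if "k \<le> m" for k
    using that
  proof (induction k)
    case 0
    have "expectation (\<lambda>\<omega>. F (Y 0 \<omega>)) \<le> expectation (\<lambda>\<omega>. b)"
      using bound[OF Y_in[of _ 0]] integrable_Y[of F 0] by (intro integral_mono) auto
    then show ?case by (simp add: prob_space)
  next
    case (Suc k)
    have "p * ?a m \<le> p * ?a k" using mono[of k] Suc.prems \<open>0 \<le> p\<close> by (intro mult_left_mono) auto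
    then show ?case using Suc step[of k] by (simp add: algebra_simps)
  qed
  from this[of m] have "expectation (\<lambda>\<omega>. F (Y m \<omega>)) \<le> b - real m * p * ?a m" by simp
  moreover have "0 \<le> expectation (\<lambda>\<omega>. F (Y m \<omega>))"
    using nonneg Y_in by (intro integral_nonneg_AE AE_I2) auto
  ultimately show ?thesis by simp
qed

end

section \<open>Activations on a time grid\<close>

lemma (in prob_space) poisson_increments_prob:
  assumes pois: "poisson_process M 1 N" and "0 < h" "finite J"
  shows "prob {\<omega> \<in> space M. \<forall>j\<in>J. N (real (Suc j) * h) \<omega> - N (real j * h) \<omega> = c j} =
    (\<Prod>j\<in>J. pmf (poisson_pmf h) (c j))"
proof (cases "J = {}")
  case True
  then show ?thesis by (simp add: prob_space)
next
  case False
  let ?u = "\<lambda>j. real j * h"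
  let ?D = "\<lambda>j \<omega>. N (?u (Suc j)) \<omega> - N (?u j) \<omega>"
  have "mono ?u" using \<open>0 < h\<close> by (auto simp: mono_def)
  have ind: "indep_vars (\<lambda>_. count_space UNIV) ?D UNIV"
  proof -
    have "\<forall>u. 0 \<le> u 0 \<and> mono u \<longrightarrow>
        indep_vars (\<lambda>_. count_space UNIV) (\<lambda>i \<omega>. N (u (Suc i)) \<omega> - N (u i) \<omega>) UNIV"
      using pois by (simp add: poisson_process_def)
    from spec[OF this, of ?u] show ?thesis using \<open>mono ?u\<close> by simp
  qed
  then have rv: "?D j \<in> measurable M (count_space UNIV)" for j
    by (auto simp: indep_vars_def2)
  have "?u j < ?u (Suc j)" "0 \<le> ?u j" "1 * (?u (Suc j) - ?u j) = h" for j
    using \<open>0 < h\<close> by (auto simp: algebra_simps)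
  then have distr: "distr M (count_space UNIV) (?D j) = measure_pmf (poisson_pmf h)" for j
    using pois[unfolded poisson_process_def] by metis
  have "{\<omega> \<in> space M. \<forall>j\<in>J. ?D j \<omega> = c j} = (\<Inter>j\<in>J. ?D j -` {c j} \<inter> space M)"
    using False by auto
  also have "prob \<dots> = (\<Prod>j\<in>J. prob (?D j -` {c j} \<inter> space M))"
    by (rule indep_varsD[OF ind False \<open>finite J\<close>]) auto
  also have "\<dots> = (\<Prod>j\<in>J. pmf (poisson_pmf h) (c j))"
  proof (rule prod.cong[OF refl])
    fix j
    have "prob (?D j -` {c j} \<inter> space M) = measure (distr M (count_space UNIV) (?D j)) {c j}"
      by (subst measure_distr[OF rv]) simp_all
    then show "prob (?D j -` {c j} \<inter> space M) = pmf (poisson_pmf h) (c j)"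
      unfolding distr by (simp add: measure_pmf_single)
  qed
  finally show ?thesis .
qed

context attraction_process
begin

text \<open>For directed edges of \<open>S\<close> and \<open>0 \<le> h\<close> the counts are
  monotone along the grid, so the subtraction never truncates.\<close>

definition activations :: "real \<Rightarrow> 'v \<times> 'v \<Rightarrow> nat \<Rightarrow> 'w \<Rightarrow> nat" where
  "activations h e k \<omega> = N e (real (Suc k) * h) \<omega> - N e (real k * h) \<omega>"

text \<open>Places grid events in the clock sigma-algebras for which \<open>independence\<close> is
  stated.\<close>

lemma activations_in_clock_sigma:
  assumes "e \<in> parcs S" "0 \<le> h" "finite J"
  shows "{\<omega> \<in> space M. \<forall>j\<in>J. activations h e j \<omega> = c j} \<in>
    sigma_sets (space M) {N e t -` A \<inter> space M | t A. 0 \<le> t}"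
proof -
  let ?\<Sigma> = "sigma (space M) {N e t -` A \<inter> space M | t A. 0 \<le> t}"
  have sub: "{N e t -` A \<inter> space M | t A. 0 \<le> t} \<subseteq> Pow (space M)" by auto
  have N: "N e t \<in> measurable ?\<Sigma> (count_space UNIV)" if "0 \<le> t" for t
    using that sub by (intro measurableI) (auto simp: space_measure_of_conv sets_measure_of intro!: sigma_sets.Basic)
  have "activations h e j \<in> measurable ?\<Sigma> (count_space UNIV)" for j
  proof -
    have [measurable]: "N e (real (Suc j) * h) \<in> measurable ?\<Sigma> (count_space UNIV)"
      "N e (real j * h) \<in> measurable ?\<Sigma> (count_space UNIV)"
      by (rule N, simp add: \<open>0 \<le> h\<close>)+
    show ?thesis unfolding activations_def[abs_def] by measurable
  qed
  then have "{\<omega> \<in> space ?\<Sigma>. activations h e j \<omega> = c j} \<in> sets ?\<Sigma>" for j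
    using measurable_sets[of "activations h e j" ?\<Sigma> "count_space UNIV" "{c j}"]
    by (simp add: vimage_def Int_def conj_commute)
  then have "{\<omega> \<in> space ?\<Sigma>. \<forall>j\<in>J. activations h e j \<omega> = c j} \<in> sets ?\<Sigma>"
    using \<open>finite J\<close> by (intro sets.sets_Collect_finite_All)
  then show ?thesis using sub by (simp add: space_measure_of_conv sets_measure_of)
qed

text \<open>The start and the different edges factor by \<open>independence\<close>; the steps of
  one edge factor by the independent Poisson increments.\<close>

lemma activations_prob:
  assumes "0 < h" "finite J" "finite (parcs S)"
  shows "prob {\<omega> \<in> space M. Q (\<zeta> 0 \<omega>) \<and> (\<forall>e\<in>parcs S. \<forall>j\<in>J. activations h e j \<omega> = c e j)} =
    prob {\<omega> \<in> space M. Q (\<zeta> 0 \<omega>)} * (\<Prod>e\<in>parcs S. \<Prod>j\<in>J. pmf (poisson_pmf h) (c e j))"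
proof -
  \<comment> \<open>The \<open>Choice\<close> branch is a dummy, as \<open>?I\<close> contains only
    the start and the clocks.\<close>
  let ?A = "\<lambda>i :: ('v, 'o) source. case i of Initial \<Rightarrow> {\<omega> \<in> space M. Q (\<zeta> 0 \<omega>)}
    | Clock e \<Rightarrow> {\<omega> \<in> space M. \<forall>j\<in>J. activations h e j \<omega> = c e j}
    | Choice e k a b \<Rightarrow> {}"
  let ?I = "insert Initial (Clock ` parcs S)"
  have "{\<omega> \<in> space M. Q (\<zeta> 0 \<omega>) \<and> (\<forall>e\<in>parcs S. \<forall>j\<in>J. activations h e j \<omega> = c e j)} = (\<Inter>i\<in>?I. ?A i)"
    by auto
  also have "prob \<dots> = (\<Prod>i\<in>?I. prob (?A i))"
  proof (rule indep_setsD[OF independence])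
    show "\<forall>j\<in>?I. ?A j \<in> (case j of
             Initial \<Rightarrow> {\<zeta> 0 -` A \<inter> space M | A. True}
           | Clock e \<Rightarrow> sigma_sets (space M) {N e t -` A \<inter> space M | t A. 0 \<le> t}
           | Choice e k a b \<Rightarrow> {U e k a b -` A \<inter> space M | A. True})"
      using activations_in_clock_sigma[of _ h J] assms
      by (auto intro!: exI[of _ "Collect Q"])
  qed (use assms in auto)
  also have "\<dots> = prob {\<omega> \<in> space M. Q (\<zeta> 0 \<omega>)} *
      (\<Prod>e\<in>parcs S. prob {\<omega> \<in> space M. \<forall>j\<in>J. activations h e j \<omega> = c e j})"
    using assms(3) by (subst prod.insert) (auto simp: prod.reindex inj_on_def)
  also have "(\<Prod>e\<in>parcs S. prob {\<omega> \<in> space M. \<forall>j\<in>J. activations h e j \<omega> = c e j}) =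
      (\<Prod>e\<in>parcs S. \<Prod>j\<in>J. pmf (poisson_pmf h) (c e j))"
    unfolding activations_def
    by (intro prod.cong refl poisson_increments_prob clocks assms)
  finally show ?thesis .
qed

text \<open>These are the driving events of the grid chain; a step with several activations lies in
  none of them.\<close>

definition only_active :: "real \<Rightarrow> 'v \<times> 'v \<Rightarrow> nat \<Rightarrow> 'w set" where
  "only_active h e k = {\<omega> \<in> space M. \<forall>e'\<in>parcs S. activations h e' k \<omega> = (if e' = e then 1 else 0)}"

definition none_active :: "real \<Rightarrow> nat \<Rightarrow> 'w set" where
  "none_active h k = {\<omega> \<in> space M. \<forall>e\<in>parcs S. activations h e k \<omega> = 0}"

lemma activations_measurable:
  assumes "e \<in> parcs S" "0 \<le> h"
  shows "activations h e k \<in> measurable M (count_space UNIV)"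
proof -
  have [measurable]: "N e (real (Suc k) * h) \<in> measurable M (count_space UNIV)"
      "N e (real k * h) \<in> measurable M (count_space UNIV)"
    using clocks[OF assms(1), unfolded poisson_process_def] \<open>0 \<le> h\<close> by auto
  show ?thesis unfolding activations_def[abs_def] by measurable
qed

lemma activations_event:
  assumes "finite (parcs S)" "0 \<le> h"
  shows "{\<omega> \<in> space M. \<forall>e\<in>parcs S. activations h e k \<omega> = c e} \<in> events"
proof (rule sets.sets_Collect_finite_All)
  fix e assume "e \<in> parcs S"
  from measurable_sets[OF activations_measurable[OF this assms(2)], of "{c e}" k]
  show "{\<omega> \<in> space M. activations h e k \<omega> = c e} \<in> events"
    by (simp add: vimage_def Int_def conj_commute)
qed (use assms in auto)

text \<open>In each step of \<open>J\<close> the chosen edge contributes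
  \<open>h * exp (- h)\<close> and every other edge \<open>exp (- h)\<close>.\<close>

lemma only_active_indep:
  assumes "0 < h" "finite J" "finite (parcs S)" and w: "\<And>j. j \<in> J \<Longrightarrow> w j \<in> parcs S"
  shows "prob {\<omega> \<in> space M. Q (\<zeta> 0 \<omega>) \<and> (\<forall>j\<in>J. \<omega> \<in> only_active h (w j) j)} =
    prob {\<omega> \<in> space M. Q (\<zeta> 0 \<omega>)} * (h * exp (- h) ^ card (parcs S)) ^ card J"
proof -
  have eq: "{\<omega> \<in> space M. Q (\<zeta> 0 \<omega>) \<and> (\<forall>j\<in>J. \<omega> \<in> only_active h (w j) j)} =
    {\<omega> \<in> space M. Q (\<zeta> 0 \<omega>) \<and> (\<forall>e\<in>parcs S. \<forall>j\<in>J. activations h e j \<omega> = (if e = w j then 1 else 0))}"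
    by (auto simp: only_active_def)
  have "prob {\<omega> \<in> space M. Q (\<zeta> 0 \<omega>) \<and> (\<forall>j\<in>J. \<omega> \<in> only_active h (w j) j)} =
    prob {\<omega> \<in> space M. Q (\<zeta> 0 \<omega>)} *
      (\<Prod>e\<in>parcs S. \<Prod>j\<in>J. pmf (poisson_pmf h) (if e = w j then 1 else 0))"
    unfolding eq by (rule activations_prob[OF assms(1-3)])
  also have "(\<Prod>e\<in>parcs S. \<Prod>j\<in>J. pmf (poisson_pmf h) (if e = w j then 1 else 0)) =
      (\<Prod>j\<in>J. \<Prod>e\<in>parcs S. (if e = w j then h else 1) * exp (- h))"
    using \<open>0 < h\<close> by (subst prod.swap) (auto intro!: prod.cong)
  also have "\<dots> = (\<Prod>j\<in>J. h * exp (- h) ^ card (parcs S))"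
    using w assms(3) by (intro prod.cong) (auto simp: prod.distrib)
  finally show ?thesis by simp
qed

text \<open>With total rate \<open>x\<close> per step, the probability of two or more activations is
  \<open>1 - (1 + x) * exp (- x)\<close>, and \<open>exp (- x)\<close> is at least
  \<open>1 - x\<close>.\<close>

lemma at_most_one_activation_prob:
  assumes "0 < h" "finite (parcs S)"
  shows "prob (space M - (none_active h k \<union> (\<Union>e\<in>parcs S. only_active h e k))) \<le> (real (card (parcs S)) * h)\<^sup>2"
proof -
  let ?E = "parcs S" and ?x = "real (card (parcs S)) * h"
  have ev: "none_active h k \<in> events" "only_active h e k \<in> events" for e
    unfolding none_active_def only_active_def by (rule activations_event; use assms in simp)+
  have evU: "(\<Union>e\<in>?E. only_active h e k) \<in> events" using ev assms(2) by (intro sets.finite_UN) auto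
  have none: "prob (none_active h k) = exp (- ?x)"
    using activations_prob[OF assms(1) _ assms(2), of "{k}" "\<lambda>_. True" "\<lambda>_ _. 0"] \<open>0 < h\<close>
    by (simp add: none_active_def prob_space flip: exp_of_nat_mult)
  have only: "prob (only_active h e k) = h * exp (- ?x)" if "e \<in> ?E" for e
  proof -
    have "only_active h e k = {\<omega> \<in> space M. True \<and> (\<forall>j\<in>{k}. \<omega> \<in> only_active h e j)}"
      by (auto simp: only_active_def)
    also have "prob \<dots> = h * exp (- ?x)"
      using only_active_indep[OF assms(1) _ assms(2), of "{k}" "\<lambda>_. e" "\<lambda>_. True"] that
      by (simp add: prob_space flip: exp_of_nat_mult)
    finally show ?thesis .
  qed
  have disj: "disjoint_family_on (\<lambda>e. only_active h e k) ?E"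
    by (auto simp: disjoint_family_on_def only_active_def)
  have disj': "none_active h k \<inter> (\<Union>e\<in>?E. only_active h e k) = {}"
    by (auto simp: none_active_def only_active_def)
  have "prob (\<Union>e\<in>?E. only_active h e k) = ?x * exp (- ?x)"
    using finite_measure_finite_Union[OF assms(2) _ disj] ev only by (simp add: image_subset_iff)
  then have "prob (none_active h k \<union> (\<Union>e\<in>?E. only_active h e k)) = (1 + ?x) * exp (- ?x)"
    using finite_measure_Union[OF ev(1) evU disj'] none by (simp add: distrib_right)
  then have "prob (space M - (none_active h k \<union> (\<Union>e\<in>?E. only_active h e k))) = 1 - (1 + ?x) * exp (- ?x)"
    using ev(1) evU by (subst prob_compl) auto
  also have "\<dots> \<le> 1 - (1 + ?x) * (1 - ?x)"
    using exp_ge_add_one_self[of "- ?x"] \<open>0 < h\<close> by (intro diff_left_mono mult_left_mono) auto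
  also have "\<dots> = ?x\<^sup>2" by (simp add: power2_eq_square algebra_simps)
  finally show ?thesis .
qed

end

section \<open>Star-like opinion graphs\<close>

locale star_opinions =
  fixes S :: "'v pair_pre_digraph" and n r \<tau> :: nat
  assumes pair_graph_S: "pair_graph S"
    and connected_S: "Digraph_Component.connected (with_proj S)"
    and radius_le: "r \<le> \<tau>"
begin

abbreviation "V \<equiv> pverts (star_like n r)"
abbreviation "confs \<equiv> pverts S \<rightarrow>\<^sub>E V"
abbreviation "act \<equiv> attract (star_like n r) \<tau> star_step"

definition active :: "('v \<Rightarrow> star_vertex) \<Rightarrow> bool" where
  "active \<eta> \<longleftrightarrow> (\<exists>(x, y)\<in>parcs S. interacting (star_like n r) \<tau> (\<eta> x) (\<eta> y))"

definition consensus :: "('v \<Rightarrow> star_vertex) \<Rightarrow> bool" where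
  "consensus \<eta> \<longleftrightarrow> (\<exists>c\<in>V. \<forall>x\<in>pverts S. \<eta> x = c)"

definition total_level :: "('v \<Rightarrow> star_vertex) \<Rightarrow> nat" where
  "total_level \<eta> = (\<Sum>x\<in>pverts S. level (\<eta> x))"

lemma finite_verts: "finite (pverts S)" and finite_arcs: "finite (parcs S)"
proof -
  interpret pair_graph S by (rule pair_graph_S)
  show "finite (pverts S)" "finite (parcs S)" by (rule pair_finite_verts pair_finite_arcs)+
qed

lemma arc_ends: assumes "(x, y) \<in> parcs S" shows "x \<in> pverts S" "y \<in> pverts S"
proof -
  interpret pair_graph S by (rule pair_graph_S)
  show "x \<in> pverts S" "y \<in> pverts S"
    using arc_fst_in_verts[OF assms] arc_snd_in_verts[OF assms] by auto
qed

lemma arc_sym: assumes "(x, y) \<in> parcs S" shows "(y, x) \<in> parcs S"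
proof -
  interpret pair_graph S by (rule pair_graph_S)
  show ?thesis using pair_sym_arcs assms by (auto simp: symmetric_def dest: symD)
qed

lemma verts_nonempty: "pverts S \<noteq> {}"
  using connected_S by (auto simp: connected_def strongly_connected_def)

lemma finite_confs: "finite confs"
  using finite_verts finite_star_verts by (intro finite_PiE) auto

text \<open>Connectedness is defined through the symmetrized digraph; \<open>S\<close> is symmetric
  already, so its own arcs suffice for reachability.\<close>

lemma connected_induct:
  assumes "x \<in> pverts S" "y \<in> pverts S" "P x" "\<And>u v. \<lbrakk>(u, v) \<in> parcs S; P u\<rbrakk> \<Longrightarrow> P v"
  shows "P y"
proof -
  interpret pair_graph S by (rule pair_graph_S)
  have "x \<rightarrow>\<^sup>*\<^bsub>with_proj (mk_symmetric (with_proj S))\<^esub> y"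
    using connected_S assms(1,2) by (auto simp: connected_def strongly_connected_def)
  then have "x \<rightarrow>\<^sup>*\<^bsub>with_proj S\<^esub> y"
    using reachable_mk_symmetric_eq[OF sym_arcs] by simp
  then show ?thesis
    by (induction rule: reachable_induct) (use assms in auto)
qed

lemma level_le: "a \<in> V \<Longrightarrow> level a \<le> r"
  by (cases a) (auto simp: star_verts)

lemma total_le: "\<eta> \<in> confs \<Longrightarrow> total_level \<eta> \<le> card (pverts S) * r"
  unfolding total_level_def using level_le by (intro sum_bounded_above[where 'a = nat, simplified]) auto

lemma interacting_iff:
  assumes "a \<in> V" "b \<in> V"
  shows "interacting (star_like n r) \<tau> a b \<longleftrightarrow> a \<noteq> b \<and> star_dist a b \<le> \<tau>"
proof -
  have "star_dist a b = 0 \<longleftrightarrow> a = b"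
    using assms by (cases a; cases b) (auto simp: star_verts)
  then show ?thesis using assms by (auto simp: interacting_def gdist_star)
qed

lemma interacting_commute:
  assumes "a \<in> V" "b \<in> V"
  shows "interacting (star_like n r) \<tau> a b \<longleftrightarrow> interacting (star_like n r) \<tau> b a"
proof -
  have "star_dist a b = star_dist b a" by (cases a; cases b) auto
  then show ?thesis using assms by (auto simp: interacting_iff)
qed

lemma conf_in: "\<lbrakk>\<eta> \<in> confs; x \<in> pverts S\<rbrakk> \<Longrightarrow> \<eta> x \<in> V"
  by auto

lemma act_closed: assumes "e \<in> parcs S" "\<eta> \<in> confs" shows "act e \<eta> \<in> confs"
proof -
  obtain x y where e: "e = (x, y)" by (cases e)
  note xy = arc_ends[of x y] assms(1)[unfolded e]
  show ?thesis
  proof (cases "interacting (star_like n r) \<tau> (\<eta> x) (\<eta> y)")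
    case True
    then have "star_step (\<eta> x) (\<eta> y) \<in> V"
      using xy conf_in[OF assms(2)] by (intro star_step_in_verts) (auto simp: interacting_iff)
    then show ?thesis using True assms xy by (auto simp: attract_def e PiE_iff extensional_def)
  qed (use assms e in \<open>auto simp: attract_def\<close>)
qed

lemma act_frozen: "\<lbrakk>\<not> active \<eta>; e \<in> parcs S\<rbrakk> \<Longrightarrow> act e \<eta> = \<eta>"
  by (cases e) (auto simp: active_def attract_def)

lemma consensus_frozen: "\<lbrakk>consensus \<eta>; e \<in> parcs S\<rbrakk> \<Longrightarrow> act e \<eta> = \<eta>"
proof (rule act_frozen)
  assume "consensus \<eta>"
  then obtain c where c: "c \<in> V" "\<And>x. x \<in> pverts S \<Longrightarrow> \<eta> x = c"
    by (auto simp: consensus_def)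
  show "\<not> active \<eta>"
  proof
    assume "active \<eta>"
    then obtain x y where "(x, y) \<in> parcs S" "interacting (star_like n r) \<tau> (\<eta> x) (\<eta> y)"
      by (auto simp: active_def)
    then show False using c(2)[of x] c(2)[of y] interacting_iff[OF c(1) c(1)] arc_ends[of x y] by simp
  qed
qed

lemma total_upd: "x \<in> pverts S \<Longrightarrow> total_level (\<eta>(x := a)) + level (\<eta> x) = total_level \<eta> + level a"
proof -
  assume x: "x \<in> pverts S"
  have "(\<Sum>y\<in>pverts S - {x}. level ((\<eta>(x := a)) y)) = (\<Sum>y\<in>pverts S - {x}. level (\<eta> y))"
    by (rule sum.cong) auto
  then show ?thesis
    using sum.remove[OF finite_verts x, of "\<lambda>y. level ((\<eta>(x := a)) y)"]
      sum.remove[OF finite_verts x, of "\<lambda>y. level (\<eta> y)"] by (simp add: total_level_def)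
qed

lemma total_act_pair:
  assumes "(x, y) \<in> parcs S" "\<eta> \<in> confs" "interacting (star_like n r) \<tau> (\<eta> x) (\<eta> y)"
  shows "total_level (act (x, y) \<eta>) = Suc (total_level \<eta>) \<and> total_level \<eta> = Suc (total_level (act (y, x) \<eta>)) \<or>
         total_level \<eta> = Suc (total_level (act (x, y) \<eta>)) \<and> total_level (act (y, x) \<eta>) = Suc (total_level \<eta>) \<or>
         total_level \<eta> = Suc (total_level (act (x, y) \<eta>)) \<and> total_level \<eta> = Suc (total_level (act (y, x) \<eta>))"
proof -
  let ?a = "\<eta> x" and ?b = "\<eta> y"
  have V: "?a \<in> V" "?b \<in> V" using conf_in[OF assms(2)] arc_ends[OF assms(1)] by auto
  have "act (x, y) \<eta> = \<eta>(x := star_step ?a ?b)" "act (y, x) \<eta> = \<eta>(y := star_step ?b ?a)"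
    using assms(3) interacting_commute[OF V] by (auto simp: attract_def)
  then have "total_level (act (x, y) \<eta>) + level ?a = total_level \<eta> + level (star_step ?a ?b)"
    "total_level (act (y, x) \<eta>) + level ?b = total_level \<eta> + level (star_step ?b ?a)"
    using total_upd arc_ends[OF assms(1)] by simp_all
  moreover have "?a \<noteq> ?b" using assms(3) interacting_iff[OF V] by simp
  ultimately show ?thesis using level_star_step[OF V] by linarith
qed

text \<open>
  Pairing each directed edge with its reverse, an interacting edge moves \<^const>\<open>total_level\<close> either once
  up and once down, or twice down.
\<close>

lemma drift_le:
  fixes f :: "nat \<Rightarrow> real" and \<delta> :: real
  assumes \<eta>: "\<eta> \<in> confs" and "0 \<le> \<delta>"
    and concave: "\<And>s. Suc s \<le> card (pverts S) * r \<Longrightarrow> f (Suc (Suc s)) + f s \<le> 2 * f (Suc s) - 2 * \<delta>"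
    and incr: "\<And>s. Suc s \<le> card (pverts S) * r \<Longrightarrow> f s \<le> f (Suc s) - \<delta>"
  shows "(\<Sum>e\<in>parcs S. f (total_level (act e \<eta>)) - f (total_level \<eta>)) \<le> (if active \<eta> then - \<delta> else 0)"
proof (cases "active \<eta>")
  case False
  then show ?thesis using act_frozen by simp
next
  case True
  let ?g = "\<lambda>e. f (total_level (act e \<eta>)) - f (total_level \<eta>)"
  have le: "total_level \<eta> \<le> card (pverts S) * r" by (rule total_le[OF \<eta>])
  have pair: "?g (x, y) + ?g (y, x) \<le> - 2 * \<delta>"
    if "(x, y) \<in> parcs S" "interacting (star_like n r) \<tau> (\<eta> x) (\<eta> y)" for x y
    using total_act_pair[OF that(1) \<eta> that(2)]
  proof (elim disjE conjE)
    assume t: "total_level (act (x, y) \<eta>) = Suc (total_level \<eta>)" "total_level \<eta> = Suc (total_level (act (y, x) \<eta>))"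
    show ?thesis using concave[of "total_level (act (y, x) \<eta>)"] le t(2) unfolding t(1) by simp
  next
    assume t: "total_level \<eta> = Suc (total_level (act (x, y) \<eta>))" "total_level (act (y, x) \<eta>) = Suc (total_level \<eta>)"
    show ?thesis using concave[of "total_level (act (x, y) \<eta>)"] le t(1) unfolding t(2) by simp
  next
    assume t: "total_level \<eta> = Suc (total_level (act (x, y) \<eta>))" "total_level \<eta> = Suc (total_level (act (y, x) \<eta>))"
    have "total_level (act (y, x) \<eta>) = total_level (act (x, y) \<eta>)" using t by simp
    then show ?thesis using incr[of "total_level (act (x, y) \<eta>)"] le t(1) by simp
  qed
  have zero: "?g (x, y) + ?g (y, x) = 0"
    if "(x, y) \<in> parcs S" "\<not> interacting (star_like n r) \<tau> (\<eta> x) (\<eta> y)" for x y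
    using that interacting_commute[OF conf_in conf_in, OF \<eta> _ \<eta>, of x y] arc_ends[OF that(1)]
    by (simp add: attract_def)
  obtain x0 y0 where e0: "(x0, y0) \<in> parcs S" "interacting (star_like n r) \<tau> (\<eta> x0) (\<eta> y0)"
    using True by (auto simp: active_def)
  have "prod.swap ` parcs S = parcs S"
    using arc_sym by (force simp: image_iff)
  moreover have "inj_on prod.swap (parcs S)" by (auto simp: inj_on_def)
  ultimately have "(\<Sum>e\<in>parcs S. ?g e) = (\<Sum>e\<in>parcs S. ?g (prod.swap e))"
    using sum.reindex[of prod.swap "parcs S" ?g] by simp
  \<comment> \<open>Reversal permutes the directed edges, so twice the drift sums each edge together
    with its reverse.\<close>
  then have "2 * (\<Sum>e\<in>parcs S. ?g e) = (\<Sum>e\<in>parcs S. ?g e) + (\<Sum>e\<in>parcs S. ?g (prod.swap e))"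
    by linarith
  also have "\<dots> = (\<Sum>e\<in>parcs S. ?g e + ?g (prod.swap e))"
    by (rule sum.distrib[symmetric])
  \<comment> \<open>All paired terms are nonpositive; keeping a single interacting edge
    suffices.\<close>
  also have "\<dots> \<le> (\<Sum>e\<in>parcs S. if e = (x0, y0) then - 2 * \<delta> else 0)"
  proof (rule sum_mono)
    fix e assume "e \<in> parcs S"
    moreover obtain x y where "e = (x, y)" by (cases e)
    ultimately show "?g e + ?g (prod.swap e) \<le> (if e = (x0, y0) then - 2 * \<delta> else 0)"
      using pair[of x y] zero[of x y] e0 \<open>0 \<le> \<delta>\<close>
      by (cases "interacting (star_like n r) \<tau> (\<eta> x) (\<eta> y)") auto
  qed
  also have "\<dots> = - 2 * \<delta>" using e0 finite_arcs by simp
  finally show ?thesis using True by simp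
qed

text \<open>An opinion of level at most \<open>\<tau> - r\<close> is within \<open>\<tau>\<close> of
  every opinion, so in a frozen configuration it spreads along arcs to all vertices.\<close>

lemma frozen_disagreement_total:
  assumes \<eta>: "\<eta> \<in> confs" and "\<not> active \<eta>" "\<not> consensus \<eta>"
  shows "card (pverts S) * (\<tau> + 1 - r) \<le> total_level \<eta>"
proof -
  have "\<tau> + 1 - r \<le> level (\<eta> x)" if x: "x \<in> pverts S" for x
  proof (rule ccontr)
    assume low: "\<not> \<tau> + 1 - r \<le> level (\<eta> x)"
    have "\<eta> y = \<eta> x" if y: "y \<in> pverts S" for y
    proof (rule connected_induct[OF x y])
      fix u v assume uv: "(u, v) \<in> parcs S" "\<eta> u = \<eta> x"
      note V = conf_in[OF \<eta> arc_ends(1)[OF uv(1)]] conf_in[OF \<eta> arc_ends(2)[OF uv(1)]]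
      have "star_dist (\<eta> u) (\<eta> v) \<le> \<tau>"
        using star_dist_le[of "\<eta> u" "\<eta> v"] level_le[OF V(2)] low uv(2) radius_le by simp
      moreover have "\<not> interacting (star_like n r) \<tau> (\<eta> u) (\<eta> v)"
        using assms(2) uv(1) by (auto simp: active_def)
      ultimately show "\<eta> v = \<eta> x" using interacting_iff[OF V] uv(2) by simp
    qed simp
    then show False using assms(3) conf_in[OF \<eta> x] by (auto simp: consensus_def)
  qed
  then show ?thesis
    unfolding total_level_def using sum_bounded_below[of "pverts S" "\<tau> + 1 - r" "\<lambda>x. level (\<eta> x)"] by simp
qed

end

section \<open>Coupling of the process with the grid chain\<close>

locale star_attraction =
  attraction_process M "star_like n r" S \<tau> N U \<zeta> + star_opinions S n r \<tau>
  for M :: "'w measure" and n r :: nat and S :: "'v pair_pre_digraph" and \<tau> N U \<zeta>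
begin

lemma process_in_confs: "\<lbrakk>\<omega> \<in> space M; 0 \<le> t\<rbrakk> \<Longrightarrow> \<zeta> t \<omega> \<in> confs"
  using measurable_space[OF process_measurable] by simp

lemma process_event1: "0 \<le> t \<Longrightarrow> {\<omega> \<in> space M. P (\<zeta> t \<omega>)} \<in> events"
  using process_event[OF countable_finite[OF finite_confs], of t t "\<lambda>\<eta> _. P \<eta>"] by simp

lemma choice_AE:
  assumes "e \<in> parcs S" "a \<in> V" "b \<in> V" "interacting (star_like n r) \<tau> a b"
  shows "AE \<omega> in M. U e k a b \<omega> = star_step a b"
proof -
  have rv: "U e k a b \<in> measurable M (count_space UNIV)"
    by (rule choices_measurable[OF assms])
  have "toward (star_like n r) a b = {star_step a b}"
    using assms interacting_iff by (intro toward_star) auto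
  then have "measure (distr M (count_space UNIV) (U e k a b)) {star_step a b} = 1"
    unfolding choices_uniform[OF assms] by (simp add: measure_pmf_single)
  then have "prob (U e k a b -` {star_step a b} \<inter> space M) = 1"
    by (simp add: measure_distr[OF rv])
  then have "AE \<omega> in M. \<omega> \<in> U e k a b -` {star_step a b} \<inter> space M"
    by (rule AE_prob_1)
  then show ?thesis by (rule AE_mp) auto
qed

text \<open>Finitely many edges and opinions and countably many activation numbers leave one common
  null set.\<close>

lemma choices_AE:
  "AE \<omega> in M. \<forall>e\<in>parcs S. \<forall>a\<in>V. \<forall>b\<in>V. \<forall>k. interacting (star_like n r) \<tau> a b \<longrightarrow> U e k a b \<omega> = star_step a b"
  by (intro AE_finite_allI finite_arcs finite_star_verts) (auto simp: AE_all_countable intro!: choice_AE)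

lemma path_AE: "AE \<omega> in M. jump_path (\<lambda>t. \<zeta> t \<omega>) (parcs S) (\<lambda>e t. N e t \<omega>) act"
  using AE_space choices_AE evolution
proof eventually_elim
  case (elim \<omega>)
  have clock: "mono_on {0..} (\<lambda>t. N e t \<omega>)" "0 \<le> t \<Longrightarrow> \<forall>\<^sub>F s in at_right t. N e s \<omega> = N e t \<omega>"
    if "e \<in> parcs S" for e t
    using clocks[OF that] elim(1) by (auto simp: poisson_process_def)
  show ?case
  proof
    fix t e assume "0 < t" "e \<in> parcs S" "jump_time (\<lambda>s. N e s \<omega>) t"
    then have "\<forall>\<^sub>F s in at_left t. \<zeta> t \<omega> = attract (star_like n r) \<tau> (\<lambda>a b. U e (N e t \<omega>) a b \<omega>) e (\<zeta> s \<omega>)"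
      using elim(3) by blast
    \<comment> \<open>Configurations are known to be in \<open>confs\<close> only at nonnegative
      times.\<close>
    moreover have "\<forall>\<^sub>F s in at_left t. 0 < s"
      using \<open>0 < t\<close> by (auto simp: eventually_at_left_field intro!: exI[of _ 0])
    ultimately show "\<forall>\<^sub>F s in at_left t. \<zeta> t \<omega> = act e (\<zeta> s \<omega>)"
    proof eventually_elim
      case (elim s)
      obtain x y where e: "e = (x, y)" by (cases e)
      have "\<zeta> s \<omega> x \<in> V" "\<zeta> s \<omega> y \<in> V"
        using process_in_confs[OF \<open>\<omega> \<in> space M\<close>, of s] elim(2) arc_ends[of x y] \<open>e \<in> parcs S\<close> e
        by auto
      then show ?case
        using elim(1) \<open>e \<in> parcs S\<close>
          \<open>\<forall>e\<in>parcs S. \<forall>a\<in>V. \<forall>b\<in>V. \<forall>k. interacting (star_like n r) \<tau> a b \<longrightarrow> U e k a b \<omega> = star_step a b\<close>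
        by (simp add: attract_def e)
    qed
  next
    fix t :: real assume "0 < t" "\<And>e. e \<in> parcs S \<Longrightarrow> \<not> jump_time (\<lambda>t. N e t \<omega>) t"
    then show "\<forall>\<^sub>F s in at_left t. \<zeta> t \<omega> = \<zeta> s \<omega>" using elim(3) by blast
  qed (use clock right_continuous elim(1) in auto)
qed

text \<open>Consensus is absorbing along almost every path, so reaching it by a fixed time is
  enough.\<close>

lemma consensus_AE:
  assumes "0 \<le> t"
  shows "AE \<omega> in M. consensus (\<zeta> t \<omega>) \<longrightarrow> \<omega> \<in> consensus_event M (star_like n r) S \<zeta>"
  using AE_space path_AE
proof eventually_elim
  case (elim \<omega>)
  then interpret jump_path "\<lambda>t. \<zeta> t \<omega>" "parcs S" "\<lambda>e t. N e t \<omega>" act by simp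
  show ?case
  proof
    assume c: "consensus (\<zeta> t \<omega>)"
    then have "\<zeta> s \<omega> = \<zeta> t \<omega>" if "t < s" for s
      using absorbed[OF assms, of s] that consensus_frozen by simp
    then show "\<omega> \<in> consensus_event M (star_like n r) S \<zeta>"
      unfolding in_consensus_event_iff[OF elim(1)] using c assms by (auto simp: consensus_def)
  qed
qed

lemma driven_chain_grid:
  assumes "0 < h"
  shows "driven_chain M (\<zeta> 0) confs (parcs S) act (only_active h) (h * exp (- h) ^ card (parcs S))"
proof
  show "\<zeta> 0 \<in> M \<rightarrow>\<^sub>M count_space confs" by (rule process_measurable) simp
  show "only_active h e k \<in> events" for e k
    unfolding only_active_def using finite_arcs assms by (intro activations_event) auto
  show "only_active h e k \<inter> only_active h e' k = {}" if "e \<in> parcs S" "e' \<in> parcs S" "e \<noteq> e'" for e e' k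
    using that by (auto simp: only_active_def)
  show "prob {\<omega> \<in> space M. \<zeta> 0 \<omega> = c \<and> (\<forall>j\<in>J. \<omega> \<in> only_active h (w j) j)} =
      prob {\<omega> \<in> space M. \<zeta> 0 \<omega> = c} * (h * exp (- h) ^ card (parcs S)) ^ card J"
    if "finite J" "\<And>j. j \<in> J \<Longrightarrow> w j \<in> parcs S" for c J w
    using only_active_indep[OF assms that(1) finite_arcs that(2), where Q = "\<lambda>\<eta>. \<eta> = c"] by simp
qed (use finite_confs finite_arcs act_closed in auto)

definition bad :: "real \<Rightarrow> nat \<Rightarrow> 'w set" where
  "bad h k = space M - (none_active h k \<union> (\<Union>e\<in>parcs S. only_active h e k))"

lemma bad_event: "0 \<le> h \<Longrightarrow> bad h k \<in> events"
  unfolding bad_def none_active_def only_active_def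
  by (intro sets.Diff sets.top sets.Un sets.finite_UN activations_event finite_arcs) auto

text \<open>Each step that is not bad has no activation or exactly one, and then path and chain make
  the same move.\<close>

lemma grid_AE:
  assumes "0 < h"
  shows "AE \<omega> in M. (\<forall>k<m. \<omega> \<notin> bad h k) \<longrightarrow>
    driven_chain.Y (\<zeta> 0) (parcs S) act (only_active h) m \<omega> = \<zeta> (real m * h) \<omega>"
  using AE_space path_AE
proof eventually_elim
  case (elim \<omega>)
  interpret chain: driven_chain M "\<zeta> 0" confs "parcs S" act "only_active h" "h * exp (- h) ^ card (parcs S)"
    by (rule driven_chain_grid[OF assms])
  interpret path: jump_path "\<lambda>t. \<zeta> t \<omega>" "parcs S" "\<lambda>e t. N e t \<omega>" act by (rule elim(2))
  show ?case
  proof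
    assume good: "\<forall>k<m. \<omega> \<notin> bad h k"
    have "chain.Y k \<omega> = \<zeta> (real k * h) \<omega>" if "k \<le> m" for k
      using that
    proof (induction k)
      case (Suc k)
      let ?s = "real k * h" and ?t = "real (Suc k) * h"
      have st: "0 \<le> ?s" "?s \<le> ?t" using \<open>0 < h\<close> by (auto intro!: mult_right_mono)
      have mono: "N e ?s \<omega> \<le> N e ?t \<omega>" if "e \<in> parcs S" for e
        using mono_onD[OF path.n_mono[OF that], of ?s ?t] st by simp
      have "\<omega> \<notin> bad h k" using good Suc.prems by simp
      then consider "\<omega> \<in> none_active h k" | e where "e \<in> parcs S" "\<omega> \<in> only_active h e k"
        using elim(1) by (auto simp: bad_def)
      then show ?case
      proof cases
        case 1
        then have act0: "activations h e k \<omega> = 0" if "e \<in> parcs S" for e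
          using that by (simp add: none_active_def)
        have "N e ?t \<omega> = N e ?s \<omega>" if "e \<in> parcs S" for e
          using act0[OF that] mono[OF that] unfolding activations_def by linarith
        then have "\<zeta> ?t \<omega> = \<zeta> ?s \<omega>" by (intro path.eq_if_counts_eq st)
        moreover have "\<omega> \<notin> only_active h e k" if "e \<in> parcs S" for e
          using act0[OF that] that by (auto simp: only_active_def)
        ultimately show ?thesis
          using Suc.IH Suc.prems chain.Y_Suc_stay[of \<omega> k] by simp
      next
        case (2 e)
        then have act1: "activations h e' k \<omega> = (if e' = e then 1 else 0)" if "e' \<in> parcs S" for e'
          using that by (simp add: only_active_def)
        have "N e ?t \<omega> = Suc (N e ?s \<omega>)"
          using act1[OF 2(1)] unfolding activations_def by simp
        moreover have "N e' ?t \<omega> = N e' ?s \<omega>" if "e' \<in> parcs S" "e' \<noteq> e" for e'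
          using act1[OF that(1)] that(2) mono[OF that(1)] unfolding activations_def by simp
        ultimately have "\<zeta> ?t \<omega> = act e (\<zeta> ?s \<omega>)" by (intro path.act_if_one_count_Suc st 2)
        then show ?thesis
          using Suc.IH Suc.prems chain.Y_Suc_act[OF 2] by simp
      qed
    qed simp
    then show "chain.Y m \<omega> = \<zeta> (real m * h) \<omega>" by simp
  qed
qed

text \<open>The three summands bound the probabilities of a step with several activations, of a
  chain still active after \<open>m\<close> steps, and of a large
  \<open>total_level\<close>.\<close>

lemma not_consensus_prob:
  assumes "0 < h" "0 < m"
  shows "prob {\<omega> \<in> space M. \<not> consensus (\<zeta> (real m * h) \<omega>)} \<le>
    real m * (real (card (parcs S)) * h)\<^sup>2 +
    (2 * real (card (pverts S) * r) + 1) * real (card (pverts S) * r) / (real m * (h * exp (- h) ^ card (parcs S))) +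
    expectation (\<lambda>\<omega>. real (total_level (\<zeta> 0 \<omega>))) / (real (card (pverts S)) * (real \<tau> + 1 - real r))"
proof -
  let ?p = "h * exp (- h) ^ card (parcs S)" and ?K = "real (card (pverts S) * r)"
  let ?q = "real (card (pverts S)) * (real \<tau> + 1 - real r)"
  interpret chain: driven_chain M "\<zeta> 0" confs "parcs S" act "only_active h" ?p
    by (rule driven_chain_grid[OF assms(1)])
  have "0 < ?p" using assms by simp
  have qpos: "0 < ?q" using verts_nonempty finite_verts radius_le by (simp add: card_gt_0_iff)
  have Y_active: "prob {\<omega> \<in> space M. active (chain.Y m \<omega>)} \<le> (2 * ?K + 1) * ?K / (real m * ?p)"
  proof -
    \<comment> \<open>increasing on the range of \<open>total_level\<close> with second difference \<open>-2\<close>\<close>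
    let ?f = "\<lambda>t. (2 * ?K + 1) * real t - (real t)\<^sup>2"
    have "real m * ?p * prob {\<omega> \<in> space M. active (chain.Y m \<omega>)} \<le> (2 * ?K + 1) * ?K"
    proof (rule chain.active_prob_bound[where F = "\<lambda>\<eta>. ?f (total_level \<eta>)"])
      fix \<eta> assume \<eta>: "\<eta> \<in> confs"
      have t: "real (total_level \<eta>) \<le> ?K" using total_le[OF \<eta>] by (simp only: of_nat_le_iff)
      have "0 \<le> real (total_level \<eta>) * (2 * ?K + 1 - real (total_level \<eta>))"
        using t by (intro mult_nonneg_nonneg) auto
      then show "0 \<le> ?f (total_level \<eta>)" by (simp add: power2_eq_square algebra_simps)
      have "(2 * ?K + 1) * real (total_level \<eta>) \<le> (2 * ?K + 1) * ?K"
        using t by (intro mult_left_mono) auto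
      then show "?f (total_level \<eta>) \<le> (2 * ?K + 1) * ?K"
        using zero_le_power2[of "real (total_level \<eta>)"] by linarith
    next
      fix \<eta> assume \<eta>: "\<eta> \<in> confs" and "active \<eta>"
      have "(\<Sum>e\<in>parcs S. ?f (total_level (act e \<eta>)) - ?f (total_level \<eta>)) \<le> (if active \<eta> then - 1 else 0)"
      proof (rule drift_le[OF \<eta>])
        fix s assume s: "Suc s \<le> card (pverts S) * r"
        show "?f (Suc (Suc s)) + ?f s \<le> 2 * ?f (Suc s) - 2 * 1"
          by (simp add: power2_eq_square algebra_simps)
        have "real (Suc s) \<le> ?K" using s by (simp only: of_nat_le_iff)
        then show "?f s \<le> ?f (Suc s) - 1"
          by (simp add: power2_eq_square algebra_simps)
      qed simp
      then show "(\<Sum>e\<in>parcs S. ?f (total_level (act e \<eta>)) - ?f (total_level \<eta>)) \<le> - 1"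
        using \<open>active \<eta>\<close> by simp
    qed (use \<open>0 < ?p\<close> act_frozen in auto)
    then show ?thesis
      using \<open>0 < ?p\<close> assms(2) by (subst pos_le_divide_eq) (auto simp: mult.commute)
  qed
  have Y_total: "prob {\<omega> \<in> space M. ?q \<le> real (total_level (chain.Y m \<omega>))} \<le>
      expectation (\<lambda>\<omega>. real (total_level (\<zeta> 0 \<omega>))) / ?q"
  proof -
    have "prob {\<omega> \<in> space M. ?q \<le> real (total_level (chain.Y m \<omega>))} \<le>
        expectation (\<lambda>\<omega>. real (total_level (chain.Y m \<omega>))) / ?q"
      using qpos chain.integrable_Y[of "\<lambda>\<eta>. real (total_level \<eta>)" m]
      by (intro integral_Markov_inequality_measure[where A = "space M"]) auto
    also have "\<dots> \<le> expectation (\<lambda>\<omega>. real (total_level (\<zeta> 0 \<omega>))) / ?q"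
    proof (intro divide_right_mono chain.supermartingale)
      fix \<eta> assume "\<eta> \<in> confs"
      \<comment> \<open>The identity has zero second differences and is increasing, so
        \<open>\<delta> = 0\<close> is admissible.\<close>
      from drift_le[OF this, of 0 real]
      show "(\<Sum>e\<in>parcs S. real (total_level (act e \<eta>)) - real (total_level \<eta>)) \<le> 0"
        by (cases "active \<eta>") simp_all
    qed (use \<open>0 < ?p\<close> qpos in auto)
    finally show ?thesis .
  qed
  have bad: "prob (\<Union>k<m. bad h k) \<le> real m * (real (card (parcs S)) * h)\<^sup>2"
  proof -
    have "prob (\<Union>k<m. bad h k) \<le> (\<Sum>k<m. prob (bad h k))"
      using bad_event assms(1) by (intro finite_measure_subadditive_finite) auto
    also have "\<dots> \<le> (\<Sum>k<m. (real (card (parcs S)) * h)\<^sup>2)"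
      unfolding bad_def by (intro sum_mono at_most_one_activation_prob assms finite_arcs)
    finally show ?thesis by simp
  qed
  let ?B1 = "\<Union>k<m. bad h k" and ?B2 = "{\<omega> \<in> space M. active (chain.Y m \<omega>)}"
    and ?B3 = "{\<omega> \<in> space M. ?q \<le> real (total_level (chain.Y m \<omega>))}"
  have ev: "?B1 \<in> events" "?B2 \<in> events" "?B3 \<in> events"
    using bad_event assms(1) chain.Y_event[of active m]
      chain.Y_event[of "\<lambda>\<eta>. ?q \<le> real (total_level \<eta>)" m] by auto
  \<comment> \<open>Off the bad steps process and chain agree at step \<open>m\<close>; a frozen
    chain without consensus has large \<open>total_level\<close>.\<close>
  have "AE \<omega> in M. \<omega> \<in> {\<omega> \<in> space M. \<not> consensus (\<zeta> (real m * h) \<omega>)} \<longrightarrow> \<omega> \<in> ?B1 \<union> ?B2 \<union> ?B3"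
    using AE_space grid_AE[OF assms(1), of m]
  proof eventually_elim
    case (elim \<omega>)
    have "?q \<le> real (total_level (chain.Y m \<omega>))"
      if "\<not> active (chain.Y m \<omega>)" "\<not> consensus (chain.Y m \<omega>)"
    proof -
      have "card (pverts S) * (\<tau> + 1 - r) \<le> total_level (chain.Y m \<omega>)"
        by (rule frozen_disagreement_total[OF chain.Y_in[OF elim(1)] that])
      then have "real (card (pverts S) * (\<tau> + 1 - r)) \<le> real (total_level (chain.Y m \<omega>))"
        by (simp only: of_nat_le_iff)
      then show ?thesis using radius_le by (simp add: of_nat_diff add.commute)
    qed
    then show ?case using elim by (auto simp: not_less)
  qed
  then have "prob {\<omega> \<in> space M. \<not> consensus (\<zeta> (real m * h) \<omega>)} \<le> prob (?B1 \<union> ?B2 \<union> ?B3)"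
    using ev by (intro finite_measure_mono_AE) auto
  also have "\<dots> \<le> prob ?B1 + prob ?B2 + prob ?B3"
    using measure_Un_le[OF ev(1,2)] measure_Un_le[OF sets.Un[OF ev(1,2)] ev(3)] by linarith
  finally show ?thesis using bad Y_active Y_total by linarith
qed

section \<open>Mean initial level and passage to the limit\<close>

lemma expectation_total:
  assumes "uniform_product_start M (star_like n r) S (\<zeta> 0)"
  shows "expectation (\<lambda>\<omega>. real (total_level (\<zeta> 0 \<omega>))) =
    real (card (pverts S)) * (real r * (real r + 1) * real n / (2 * (1 + real r * real n)))"
proof -
  let ?c = "real r * (real r + 1) * real n / (2 * (1 + real r * real n))"
  have "V \<noteq> {}" using star_verts(1) by blast
  have sum: "(\<Sum>a\<in>V. real (level a)) = real r * (real r + 1) * real n / 2"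
    using arg_cong[OF sum_level_star[of n r], of real] by (simp add: field_simps)
  have "measure_pmf.expectation (pmf_of_set V) (\<lambda>a. real (level a)) = (\<Sum>a\<in>V. real (level a)) / real (card V)"
    by (rule integral_pmf_of_set[OF \<open>V \<noteq> {}\<close> finite_star_verts])
  also have "\<dots> = ?c"
    unfolding sum card_star_verts
    by (simp only: divide_divide_eq_left of_nat_add of_nat_mult of_nat_1)
  finally have pmf: "measure_pmf.expectation (pmf_of_set V) (\<lambda>a. real (level a)) = ?c" .
  have int: "integrable M (\<lambda>\<omega>. real (level (\<zeta> 0 \<omega> x)))"
    and exp: "expectation (\<lambda>\<omega>. real (level (\<zeta> 0 \<omega> x))) = ?c" if x: "x \<in> pverts S" for x
  proof -
    have rv: "(\<lambda>\<omega>. \<zeta> 0 \<omega> x) \<in> M \<rightarrow>\<^sub>M count_space UNIV"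
      using assms x by (auto simp: uniform_product_start_def indep_vars_def2)
    have distr: "distr M (count_space UNIV) (\<lambda>\<omega>. \<zeta> 0 \<omega> x) = measure_pmf (pmf_of_set V)"
      using assms x by (simp add: uniform_product_start_def)
    show "expectation (\<lambda>\<omega>. real (level (\<zeta> 0 \<omega> x))) = ?c"
      using integral_distr[OF rv, of "\<lambda>a. real (level a)"] pmf by (simp add: distr)
    show "integrable M (\<lambda>\<omega>. real (level (\<zeta> 0 \<omega> x)))"
    proof (rule integrable_const_bound[where B = "real r"])
      show "AE \<omega> in M. norm (real (level (\<zeta> 0 \<omega> x))) \<le> real r"
        using level_le conf_in[OF process_in_confs x] by (intro AE_I2) simp
      show "(\<lambda>\<omega>. real (level (\<zeta> 0 \<omega> x))) \<in> borel_measurable M"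
        by (rule measurable_compose[OF rv]) simp
    qed
  qed
  have "expectation (\<lambda>\<omega>. real (total_level (\<zeta> 0 \<omega>))) = (\<Sum>x\<in>pverts S. expectation (\<lambda>\<omega>. real (level (\<zeta> 0 \<omega> x))))"
    unfolding total_level_def of_nat_sum using int by (rule Bochner_Integration.integral_sum)
  also have "\<dots> = real (card (pverts S)) * ?c" using exp by simp
  finally show ?thesis .
qed

text \<open>Coupling the mesh to the horizon turns both error terms into a constant over the
  horizon; the initial-level term does not depend on either and survives in the limit.\<close>

lemma consensus_event_prob_ge:
  assumes "uniform_product_start M (star_like n r) S (\<zeta> 0)"
  shows "1 - (1 / (real \<tau> + 1 - real r)) * ((real r * (real r + 1) * real n) / (2 * (1 + real r * real n)))
    \<le> prob (consensus_event M (star_like n r) S \<zeta>)" (is "1 - ?b \<le> _")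
proof -
  let ?E = "real (card (parcs S))" and ?K = "real (card (pverts S) * r)"
  let ?c = "?E\<^sup>2 + (2 * ?K + 1) * ?K * exp ?E"
  have "1 - ?b - ?c / real (Suc i) \<le> prob (consensus_event M (star_like n r) S \<zeta>)" for i
  proof -
    let ?j = "real (Suc i)"
    \<comment> \<open>time horizon \<open>m * h = ?j\<close>, with a mesh so fine that \<open>m * h\<^sup>2\<close> vanishes as well\<close>
    define h where "h = 1 / ?j ^ 2"
    define m where "m = Suc i ^ 3"
    have h: "0 < h" "h \<le> 1" by (auto simp: h_def)
    have "j ^ 3 * (1 / j ^ 2) = j" "j ^ 3 * (1 / j ^ 2)\<^sup>2 = 1 / j" if "0 < j" for j :: real
      using that by (simp_all add: power2_eq_square power3_eq_cube field_simps)
    moreover have "real m = ?j ^ 3" by (simp add: m_def)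
    ultimately have m: "real m * h = ?j" "real m * h\<^sup>2 = 1 / ?j" "0 < m"
      unfolding h_def by (simp_all only: of_nat_0_less_iff zero_less_Suc m_def zero_less_power)
    \<comment> \<open>Since \<open>h \<le> 1\<close>, the mesh-dependent factor has a positive lower
      bound independent of \<open>i\<close>.\<close>
    have "exp (- ?E) \<le> exp (- h) ^ card (parcs S)"
      using h mult_left_mono[of h 1 ?E] by (simp flip: exp_of_nat_mult)
    then have "(2 * ?K + 1) * ?K / (?j * exp (- h) ^ card (parcs S)) \<le> (2 * ?K + 1) * ?K / (?j * exp (- ?E))"
      by (intro divide_left_mono mult_left_mono) auto
    also have "\<dots> = (2 * ?K + 1) * ?K * exp ?E / ?j"
      by (simp add: exp_minus field_simps)
    finally have 1: "(2 * ?K + 1) * ?K / (real m * (h * exp (- h) ^ card (parcs S))) \<le> (2 * ?K + 1) * ?K * exp ?E / ?j"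
      using m(1) by (simp add: mult.assoc[symmetric])
    have "real m * (?E * h)\<^sup>2 = ?E\<^sup>2 * (real m * h\<^sup>2)"
      by (simp add: power_mult_distrib)
    then have 2: "real m * (?E * h)\<^sup>2 = ?E\<^sup>2 / ?j"
      unfolding m(2) by simp
    have 3: "expectation (\<lambda>\<omega>. real (total_level (\<zeta> 0 \<omega>))) / (real (card (pverts S)) * (real \<tau> + 1 - real r)) = ?b"
      using verts_nonempty finite_verts unfolding expectation_total[OF assms] by (simp add: card_gt_0_iff mult.commute mult.left_commute)
    have "prob {\<omega> \<in> space M. \<not> consensus (\<zeta> ?j \<omega>)} \<le> ?c / ?j + ?b"
      using not_consensus_prob[OF h(1) m(3)] 1 unfolding m(1) 2 3 by (simp add: add_divide_distrib)
    moreover have "prob {\<omega> \<in> space M. \<not> consensus (\<zeta> ?j \<omega>)} = 1 - prob {\<omega> \<in> space M. consensus (\<zeta> ?j \<omega>)}"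
      using prob_neg[of "\<lambda>\<omega>. consensus (\<zeta> ?j \<omega>)"] process_event1[of ?j consensus] by simp
    moreover have "prob {\<omega> \<in> space M. consensus (\<zeta> ?j \<omega>)} \<le> prob (consensus_event M (star_like n r) S \<zeta>)"
      using consensus_AE[of ?j] consensus_event_measurable[OF countable_finite[OF finite_confs]]
      by (intro finite_measure_mono_AE) auto
    ultimately show ?thesis by linarith
  qed
  moreover have "(\<lambda>i. 1 - ?b - ?c / real (Suc i)) \<longlonglongrightarrow> 1 - ?b - 0"
    by (intro tendsto_intros LIMSEQ_Suc[OF lim_const_over_n])
  ultimately have "1 - ?b - 0 \<le> prob (consensus_event M (star_like n r) S \<zeta>)"
    by (intro LIMSEQ_le_const2) auto
  then show ?thesis by simp
qed

end

theorem theorem6: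
  fixes n r \<tau> :: nat
    and S :: "'v pair_pre_digraph"
    and M :: "'w measure"
    and N :: "'v \<times> 'v \<Rightarrow> real \<Rightarrow> 'w \<Rightarrow> nat"
    and U :: "'v \<times> 'v \<Rightarrow> nat \<Rightarrow> star_vertex \<Rightarrow> star_vertex \<Rightarrow> 'w \<Rightarrow> star_vertex"
    and \<zeta> :: "real \<Rightarrow> 'w \<Rightarrow> 'v \<Rightarrow> star_vertex"
  assumes "n \<ge> 2" and "r \<ge> 1"
    and "pair_graph S" and "Digraph_Component.connected (with_proj S)"
    and "r \<le> \<tau>" and "\<tau> < 2 * r"
    and "attraction_process M (star_like n r) S \<tau> N U \<zeta>"
    and "uniform_product_start M (star_like n r) S (\<zeta> 0)"
  shows "measure M (consensus_event M (star_like n r) S \<zeta>)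
           \<ge> 1 - (1 / (real \<tau> + 1 - real r)) * ((real r * (real r + 1) * real n) / (2 * (1 + real r * real n)))"
proof -
  have "star_attraction M n r S \<tau> N U \<zeta>"
    by (intro star_attraction.intro star_opinions.intro assms)
  then show ?thesis using assms(8) by (rule star_attraction.consensus_event_prob_ge)
qed

end
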